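(* Let $\mathbb F$ be a field of characteristic different from $2$ and $3$, $V=\mathbb F^4$ and $G=\mathbb Z_2^3$. Let $\sigma\colon G\times G\to \mathrm{Bil}(V\times V,V)$, written $\sigma_{i,j}:=\sigma(g_i,g_j)$, be the map given as follows: for every $i\in I=\{1,\dots,7\}$ and all $r=(a_1,a_2,a_3,a_4)$, $s=(b_1,b_2,b_3,b_4)\in V$, $$\begin{array}{l}\sigma_{i,i+1}(r,s)=(-a_2b_1-a_3b_3,\,-a_2b_3-a_3b_1,\,a_1b_2+a_4b_4,\,a_1b_4+a_4b_2),\\ \sigma_{i,i+2}(r,s)=(a_2b_3+a_4b_4,\,-a_1b_1-a_3b_2,\,-a_1b_2-a_3b_1,\,a_2b_4+a_4b_3),\\ \sigma_{i,i+4}(r,s)=(-a_1b_2-a_2b_3,\,a_3b_1+a_4b_4,\,-a_1b_3-a_2b_2,\,a_3b_4+a_4b_1),\end{array}$$ $\sigma_{0,i}(r,s)=\sigma_{i,0}(r,s)=\sigma_{0,0}(r,s)=\sigma_{i,i}(r,s)=0$, and $$\sigma_{i,i+3}(r,s)=-\sigma_{i,i+4}(s,r),\quad \sigma_{i,i+5}(r,s)=-\sigma_{i,i+2}(s,r),\quad \sigma_{i,i+6}(r,s)=-\sigma_{i,i+1}(s,r).$$ Then the generalized group algebra $\mathfrak L=V^\sigma[G]$ is a Lie algebra. Furthermore, its center is $\mathfrak z(\mathfrak L)=\{rg_0:r\in V\}$, which has dimension $4$, and its derived algebra $[\mathfrak L,\mathfrak L]$ is the linear span of $\{rg_i:r\in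 V,\ i\in I\}$ (denoted $V^\sigma[G^\times]$), which is simple and isomorphic to $\mathfrak{so}_8(\mathbb F)$.
   Context: Generalized group algebra: for an abelian group $(G,+)$, an $\mathbb F$-vector space $V$ and a map $\sigma\colon G\times G\to\mathrm{Bil}(V\times V,V)$, $(g,h)\mapsto\sigma_{g,h}$ (with $\mathrm{Bil}(V\times V,V)$ the bilinear maps $V\times V\to V$), $V^\sigma[G]$ is the vector space of formal sums $\sum_{g\in G}r_g g$, $r_g\in V$ (finitely many nonzero; two are equal iff all coefficients agree), with product obtained by bilinear extension from $(rg)\cdot(sh)=\sigma_{g,h}(r,s)(g+h)$. When this product is a Lie bracket it is written $[\cdot,\cdot]$. Labelling of $G=\mathbb Z_2^3$: $g_0=(0,0,0)$, $g_1=(1,0,0)$, $g_2=(0,1,0)$, $g_3=(0,0,1)$, $g_4=(1,1,0)$, $g_5=(0,1,1)$, $g_6=(1,1,1)$, $g_7=(1,0,1)$. With $I=\{1,\dots,7\}$, sums of indices such as $i+1$, $i+3$ (with $i\in I$) are taken modulo $7$ with values in $I$ (so the residue $0$ is represented by $7$; the index $0$ is distinct and denotes the neutral element). One has $g_i+g_{i+1}=g_{i+3}$ for all $i\in I$. $G^\times=G\setminus\{g_0\}$. $\mathfrak{so}_8(\mathbb F)=\{f\in\mathfrak{gl}_8(\mathbb F):\langle f(x),y\rangle+\langle x,f(y)\rangle=0\ \forall x,y\in\mathbb F^8\}$ for the standard bilinear form $\langle x,y\rangle=\sum x_iy_i$ on $\mathbb F^8$. *)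

theory Defs
  imports "HOL-Analysis.Analysis" "HOL-Library.Poly_Mapping" "HOL-Library.Z2"
begin

section \<open>Lie algebras\<close>

locale lie_algebra = vector_space scale
  for scale :: "'a::field \<Rightarrow> 'b::ab_group_add \<Rightarrow> 'b" +
  fixes br :: "'b \<Rightarrow> 'b \<Rightarrow> 'b"
  assumes br_add_left: "br (x + y) z = br x z + br y z"
    and br_add_right: "br x (y + z) = br x y + br x z"
    and br_scale_left: "br (scale c x) y = scale c (br x y)"
    and br_scale_right: "br x (scale c y) = scale c (br x y)"
    and br_self: "br x x = 0"
    and jacobi: "br x (br y z) + br y (br z x) + br z (br x y) = 0"

definition lie_center :: "('b::zero \<Rightarrow> 'b \<Rightarrow> 'b) \<Rightarrow> 'b set" where
  "lie_center br = {z. \<forall>x. br z x = 0}"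

definition lie_derived :: "('a::field \<Rightarrow> 'b::ab_group_add \<Rightarrow> 'b) \<Rightarrow> ('b \<Rightarrow> 'b \<Rightarrow> 'b) \<Rightarrow> 'b set" where
  "lie_derived scl br = module.span scl {br x y | x y. True}"

definition lie_subalgebra ::
  "('a::field \<Rightarrow> 'b::ab_group_add \<Rightarrow> 'b) \<Rightarrow> ('b \<Rightarrow> 'b \<Rightarrow> 'b) \<Rightarrow> 'b set \<Rightarrow> bool" where
  "lie_subalgebra scl br S \<longleftrightarrow>
     module.subspace scl S \<and> (\<forall>x\<in>S. \<forall>y\<in>S. br x y \<in> S)"

text \<open>The following notions regard a subalgebra \<open>S\<close> as a Lie algebra in its own right:
  ideals of \<open>S\<close> absorb brackets with elements of \<open>S\<close> only.\<close>

definition lie_ideal ::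
  "('a::field \<Rightarrow> 'b::ab_group_add \<Rightarrow> 'b) \<Rightarrow> ('b \<Rightarrow> 'b \<Rightarrow> 'b) \<Rightarrow> 'b set \<Rightarrow> 'b set \<Rightarrow> bool" where
  "lie_ideal scl br S I \<longleftrightarrow>
     I \<subseteq> S \<and> module.subspace scl I \<and> (\<forall>x\<in>S. \<forall>y\<in>I. br x y \<in> I)"

definition lie_simple ::
  "('a::field \<Rightarrow> 'b::ab_group_add \<Rightarrow> 'b) \<Rightarrow> ('b \<Rightarrow> 'b \<Rightarrow> 'b) \<Rightarrow> 'b set \<Rightarrow> bool" where
  "lie_simple scl br S \<longleftrightarrow>
     lie_subalgebra scl br S \<and>
     (\<exists>x\<in>S. \<exists>y\<in>S. br x y \<noteq> 0) \<and>
     (\<forall>I. lie_ideal scl br S I \<longrightarrow> I = {0} \<or> I = S)"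

definition lie_isomorphic ::
  "('a::field \<Rightarrow> 'b::ab_group_add \<Rightarrow> 'b) \<Rightarrow> ('b \<Rightarrow> 'b \<Rightarrow> 'b) \<Rightarrow> 'b set \<Rightarrow>
   ('a \<Rightarrow> 'c::ab_group_add \<Rightarrow> 'c) \<Rightarrow> ('c \<Rightarrow> 'c \<Rightarrow> 'c) \<Rightarrow> 'c set \<Rightarrow> bool" where
  "lie_isomorphic scl br S scl' br' T \<longleftrightarrow>
     (\<exists>\<phi>. bij_betw \<phi> S T \<and>
       (\<forall>x\<in>S. \<forall>y\<in>S. \<phi> (x + y) = \<phi> x + \<phi> y) \<and>
       (\<forall>c. \<forall>x\<in>S. \<phi> (scl c x) = scl' c (\<phi> x)) \<and>
       (\<forall>x\<in>S. \<forall>y\<in>S. \<phi> (br x y) = br' (\<phi> x) (\<phi> y)))"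

section \<open>The orthogonal Lie algebra\<close>

text \<open>Endomorphisms of \<open>\<bbbF>\<^sup>n\<close> are given by their matrices.  On \<open>'a^'n^'n\<close> the library operation
  \<open>*s\<close> takes row vectors as scalars, hence the separate scaling by elements of the field.\<close>

definition mat_scale :: "'a::field \<Rightarrow> 'a^'n^'n \<Rightarrow> 'a^'n^'n" where
  "mat_scale c A = map_matrix (\<lambda>x. c * x) A"

definition mat_br :: "'a::field^'n^'n \<Rightarrow> 'a^'n^'n \<Rightarrow> 'a^'n^'n" where
  "mat_br A B = A ** B - B ** A"

definition std_form :: "'a::field^'n \<Rightarrow> 'a^'n \<Rightarrow> 'a" where
  "std_form x y = (\<Sum>i\<in>UNIV. x $ i * y $ i)"

definition so_mat :: "('a::field^'n^'n) set" where
  "so_mat = {A. \<forall>x y. std_form (A *v x) y + std_form x (A *v y) = 0}"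

lemma matrix_plus_left: "(A + B) ** C = A ** C + B ** (C :: 'a::field^'n^'n)"
  by (simp add: matrix_matrix_mult_def vec_eq_iff distrib_right sum.distrib)

lemma matrix_minus_left: "(A - B) ** C = A ** C - B ** (C :: 'a::field^'n^'n)"
  by (simp add: matrix_matrix_mult_def vec_eq_iff left_diff_distrib sum_subtractf)

lemma matrix_minus_right: "C ** (A - B) = C ** A - C ** (B :: 'a::field^'n^'n)"
  by (simp add: matrix_matrix_mult_def vec_eq_iff right_diff_distrib sum_subtractf)

lemma mat_scale_mult_left: "mat_scale c A ** B = mat_scale c (A ** B)"
  by (simp add: mat_scale_def map_matrix_def matrix_matrix_mult_def vec_eq_iff
      sum_distrib_left mult.assoc)

lemma mat_scale_mult_right: "A ** mat_scale c B = mat_scale c (A ** B)"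
  by (simp add: mat_scale_def map_matrix_def matrix_matrix_mult_def vec_eq_iff
      sum_distrib_left mult.left_commute)

lemma lie_algebra_gl: "lie_algebra mat_scale (mat_br :: 'a::field^'n^'n \<Rightarrow> _)"
proof -
  have scale_diff: "mat_scale c (A - B) = mat_scale c A - mat_scale c B" for c and A B :: "'a^'n^'n"
    by (simp add: mat_scale_def map_matrix_def vec_eq_iff algebra_simps)
  have "vector_space (mat_scale :: 'a \<Rightarrow> 'a^'n^'n \<Rightarrow> _)"
    by unfold_locales (simp_all add: mat_scale_def map_matrix_def vec_eq_iff algebra_simps)
  then show ?thesis
    unfolding lie_algebra_def lie_algebra_axioms_def
    by (simp add: mat_br_def matrix_add_ldistrib matrix_plus_left matrix_minus_left
        matrix_minus_right mat_scale_mult_left mat_scale_mult_right scale_diff matrix_mul_assoc)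
qed

section \<open>Generalized group algebras\<close>

definition bil_map :: "('a::field \<Rightarrow> 'v::ab_group_add \<Rightarrow> 'v) \<Rightarrow> ('v \<Rightarrow> 'v \<Rightarrow> 'v) \<Rightarrow> bool" where
  "bil_map scl f \<longleftrightarrow>
     (\<forall>r. Vector_Spaces.linear scl scl (\<lambda>s. f r s)) \<and>
     (\<forall>s. Vector_Spaces.linear scl scl (\<lambda>r. f r s))"

text \<open>The formal sum with coefficients \<open>r\<^sub>g\<close> is the finitely supported function \<open>g \<mapsto> r\<^sub>g\<close>; in
  particular \<open>rg\<close> is \<open>Poly_Mapping.single g r\<close>.\<close>

definition gga_scale ::
  "('a::field \<Rightarrow> 'v::ab_group_add \<Rightarrow> 'v) \<Rightarrow> 'a \<Rightarrow> ('g \<Rightarrow>\<^sub>0 'v) \<Rightarrow> ('g \<Rightarrow>\<^sub>0 'v)" where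
  "gga_scale scl c x = Poly_Mapping.map (scl c) x"

definition gga_mult ::
  "('g::ab_group_add \<Rightarrow> 'g \<Rightarrow> 'v::ab_group_add \<Rightarrow> 'v \<Rightarrow> 'v) \<Rightarrow> ('g \<Rightarrow>\<^sub>0 'v) \<Rightarrow> ('g \<Rightarrow>\<^sub>0 'v) \<Rightarrow> ('g \<Rightarrow>\<^sub>0 'v)"
  where
  "gga_mult \<sigma> x y =
     (\<Sum>g\<in>Poly_Mapping.keys x. \<Sum>h\<in>Poly_Mapping.keys y.
        Poly_Mapping.single (g + h) (\<sigma> g h (Poly_Mapping.lookup x g) (Poly_Mapping.lookup y h)))"

lemma gga_mult_single:
  assumes "\<And>g h. \<sigma> g h 0 s = 0" "\<And>g h. \<sigma> g h r 0 = 0"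
  shows "gga_mult \<sigma> (Poly_Mapping.single g r) (Poly_Mapping.single h s) =
    Poly_Mapping.single (g + h) (\<sigma> g h r s)"
  using assms by (cases "r = 0"; cases "s = 0") (simp_all add: gga_mult_def)

section \<open>The group \<open>\<int>\<^sub>2\<^sup>3\<close> and the structure map\<close>

type_synonym Z2_3 = "bit \<times> bit \<times> bit"

definition lab :: "nat \<Rightarrow> Z2_3" where
  "lab i = [(0,0,0), (1,0,0), (0,1,0), (0,0,1), (1,1,0), (0,1,1), (1,1,1), (1,0,1)] ! i"

text \<open>Reduction modulo 7 with representatives \<open>1, \<dots>, 7\<close>; only applied to positive arguments.\<close>

definition idx :: "nat \<Rightarrow> nat" where
  "idx n = (if n mod 7 = 0 then 7 else n mod 7)"

lemma ball_1_7: "(\<forall>i\<in>{1..7::nat}. P i) \<longleftrightarrow> P 1 \<and> P 2 \<and> P 3 \<and> P 4 \<and> P 5 \<and> P 6 \<and> P 7"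
proof -
  have "{1..7::nat} = {1, 2, 3, 4, 5, 6, 7}" by auto
  then show ?thesis by simp
qed

lemma lab_add: "i \<in> {1..7} \<Longrightarrow> lab i + lab (idx (i + 1)) = lab (idx (i + 3))"
proof -
  have "\<forall>i\<in>{1..7}. lab i + lab (idx (i + 1)) = lab (idx (i + 3))"
    unfolding ball_1_7 by (simp add: lab_def idx_def)
  then show "i \<in> {1..7} \<Longrightarrow> lab i + lab (idx (i + 1)) = lab (idx (i + 3))" by blast
qed

text \<open>The clauses fix the value at \<open>(g\<^sub>i, g\<^sub>j)\<close> for every residue of \<open>j - i\<close> modulo 7 and
  whenever \<open>i = 0\<close> or \<open>j = 0\<close>, so they determine \<open>\<sigma>\<close> completely; existence is proved below.\<close>

definition is_structure_map :: "(Z2_3 \<Rightarrow> Z2_3 \<Rightarrow> 'a::field^4 \<Rightarrow> 'a^4 \<Rightarrow> 'a^4) \<Rightarrow> bool" where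
  "is_structure_map \<sigma> \<longleftrightarrow>
     (\<forall>g h. bil_map (*s) (\<sigma> g h)) \<and>
     (\<forall>i\<in>{1..7}. \<forall>a1 a2 a3 a4 b1 b2 b3 b4.
        \<sigma> (lab i) (lab (idx (i + 1))) (vector [a1, a2, a3, a4]) (vector [b1, b2, b3, b4]) =
          vector [- a2 * b1 - a3 * b3, - a2 * b3 - a3 * b1, a1 * b2 + a4 * b4, a1 * b4 + a4 * b2] \<and>
        \<sigma> (lab i) (lab (idx (i + 2))) (vector [a1, a2, a3, a4]) (vector [b1, b2, b3, b4]) =
          vector [a2 * b3 + a4 * b4, - a1 * b1 - a3 * b2, - a1 * b2 - a3 * b1, a2 * b4 + a4 * b3] \<and>
        \<sigma> (lab i) (lab (idx (i + 4))) (vector [a1, a2, a3, a4]) (vector [b1, b2, b3, b4]) =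
          vector [- a1 * b2 - a2 * b3, a3 * b1 + a4 * b4, - a1 * b3 - a2 * b2, a3 * b4 + a4 * b1]) \<and>
     (\<forall>r s. \<sigma> (lab 0) (lab 0) r s = 0) \<and>
     (\<forall>i\<in>{1..7}. \<forall>r s.
        \<sigma> (lab 0) (lab i) r s = 0 \<and>
        \<sigma> (lab i) (lab 0) r s = 0 \<and>
        \<sigma> (lab i) (lab i) r s = 0 \<and>
        \<sigma> (lab i) (lab (idx (i + 3))) r s = - \<sigma> (lab i) (lab (idx (i + 4))) s r \<and>
        \<sigma> (lab i) (lab (idx (i + 5))) r s = - \<sigma> (lab i) (lab (idx (i + 2))) s r \<and>
        \<sigma> (lab i) (lab (idx (i + 6))) r s = - \<sigma> (lab i) (lab (idx (i + 1))) s r)"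

lemma vector_4:
  "(vector [w, x, y, z] :: 'a::zero^4) $ 1 = w" "(vector [w, x, y, z] :: 'a^4) $ 2 = x"
  "(vector [w, x, y, z] :: 'a^4) $ 3 = y" "(vector [w, x, y, z] :: 'a^4) $ 4 = z"
  unfolding vector_def by simp_all

lemma is_structure_map_exists:
  "\<exists>\<sigma> :: Z2_3 \<Rightarrow> Z2_3 \<Rightarrow> 'a::field^4 \<Rightarrow> 'a^4 \<Rightarrow> 'a^4. is_structure_map \<sigma>"
proof -
  define s1 s2 s4 :: "'a^4 \<Rightarrow> 'a^4 \<Rightarrow> 'a^4" where
    "s1 a b = vector [- a$2 * b$1 - a$3 * b$3, - a$2 * b$3 - a$3 * b$1,
                      a$1 * b$2 + a$4 * b$4, a$1 * b$4 + a$4 * b$2]" and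
    "s2 a b = vector [a$2 * b$3 + a$4 * b$4, - a$1 * b$1 - a$3 * b$2,
                      - a$1 * b$2 - a$3 * b$1, a$2 * b$4 + a$4 * b$3]" and
    "s4 a b = vector [- a$1 * b$2 - a$2 * b$3, a$3 * b$1 + a$4 * b$4,
                      - a$1 * b$3 - a$2 * b$2, a$3 * b$4 + a$4 * b$1]" for a b
  define sg :: "nat \<Rightarrow> 'a^4 \<Rightarrow> 'a^4 \<Rightarrow> 'a^4" where
    "sg k a b = (if k = 1 then s1 a b else if k = 2 then s2 a b else if k = 4 then s4 a b
       else if k = 3 then - s4 b a else if k = 5 then - s2 b a else if k = 6 then - s1 b a else 0)"
    for k a b
  define ind :: "Z2_3 \<Rightarrow> nat" where
    "ind g = (if g = (1,0,0) then 1 else if g = (0,1,0) then 2 else if g = (0,0,1) then 3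
       else if g = (1,1,0) then 4 else if g = (0,1,1) then 5 else if g = (1,1,1) then 6
       else if g = (1,0,1) then 7 else 0)" for g
  define \<sigma> :: "Z2_3 \<Rightarrow> Z2_3 \<Rightarrow> 'a^4 \<Rightarrow> 'a^4 \<Rightarrow> 'a^4" where
    "\<sigma> g h = (if ind g = 0 \<or> ind h = 0 then (\<lambda>a b. 0) else sg ((ind h + 7 - ind g) mod 7))" for g h
  have vs: "vector_space ((*s) :: 'a \<Rightarrow> 'a^4 \<Rightarrow> 'a^4)" by (rule vec.vector_space_axioms)
  have b: "bil_map (*s) s1" "bil_map (*s) s2" "bil_map (*s) s4"
    unfolding bil_map_def Vector_Spaces.linear_iff s1_def s2_def s4_def
    by (auto simp: vs vec_eq_iff forall_4 vector_4 algebra_simps)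
  have b': "bil_map (*s) (\<lambda>r s. - f s r)" if "bil_map (*s) f" for f :: "'a^4 \<Rightarrow> 'a^4 \<Rightarrow> 'a^4"
    using that unfolding bil_map_def Vector_Spaces.linear_iff by simp
  have b0: "bil_map (*s) (\<lambda>r s. 0 :: 'a^4)"
    unfolding bil_map_def Vector_Spaces.linear_iff by (simp add: vs)
  have bsg: "bil_map (*s) (sg k)" for k
  proof -
    have "sg k \<in> {s1, s2, s4, (\<lambda>r s. - s4 s r), (\<lambda>r s. - s2 s r), (\<lambda>r s. - s1 s r), (\<lambda>r s. 0)}"
      by (simp add: sg_def fun_eq_iff)
    then show ?thesis
      using b b0 b'[OF b(1)] b'[OF b(2)] b'[OF b(3)] by (elim insertE emptyE) simp_all
  qed
  have bil: "bil_map (*s) (\<sigma> g h)" for g h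
    by (simp add: \<sigma>_def b0 bsg)
  have ind: "ind (lab 0) = 0" "\<forall>i\<in>{1..7}. ind (lab i) = i"
    unfolding ball_1_7 by (simp_all add: ind_def lab_def)
  have lab0: "\<sigma> (lab 0) g r s = 0" "\<sigma> g (lab 0) r s = 0" for g r s
    by (simp_all add: \<sigma>_def ind)
  have sig: "\<sigma> (lab i) (lab (idx (i + k))) = sg k" if "i \<in> {1..7}" "k < 7" for i k
  proof -
    have "idx (i + k) \<in> {1..7}" by (auto simp: idx_def)
    moreover have "(idx (i + k) + 7 - i) mod 7 = k"
    proof -
      have "\<forall>i\<in>{1..7}. \<forall>k\<in>{0, 1, 2, 3, 4, 5, 6}. (idx (i + k) + 7 - i) mod 7 = k"
        unfolding ball_1_7 by (simp add: idx_def)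
      moreover have "k \<in> {0, 1, 2, 3, 4, 5, 6}" using that by auto
      ultimately show "(idx (i + k) + 7 - i) mod 7 = k" using that(1) by (metis (lifting))
    qed
    ultimately show ?thesis using that ind by (auto simp: \<sigma>_def)
  qed
  have "\<forall>i\<in>{1..7}. idx (i + 0) = i"
    unfolding ball_1_7 by (simp add: idx_def)
  then have diag: "\<sigma> (lab i) (lab i) = sg 0" if "i \<in> {1..7}" for i
    using sig[of i 0] that by auto
  have "is_structure_map \<sigma>"
    unfolding is_structure_map_def
  proof (intro conjI ballI allI)
    show "bil_map (*s) (\<sigma> g h)" for g h by (rule bil)
  qed (simp_all only: lab0, simp_all only: sig diag, simp_all add: sg_def s1_def s2_def s4_def vector_4)
  then show ?thesis by blast
qed

end

theory Submission
  imports Defs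
begin

text \<open>Index the coordinates of \<open>\<bbbF>\<^sup>8\<close> by \<open>0, \<dots>, 7\<close>, that is, by the elements of \<open>\<int>\<^sub>2\<^sup>3\<close>, and write
  \<open>rot p q = E\<^sub>p\<^sub>q - E\<^sub>q\<^sub>p\<close>.  Since \<open>[rot p q, rot q r] = rot p r\<close>, giving \<open>rot p q\<close> the degree
  \<open>g\<^sub>p + g\<^sub>q\<close> makes \<open>so\<^sub>8\<close> a graded algebra whose component of degree \<open>g\<^sub>i\<close> has dimension 4, with one basis
  vector for each of the pairs \<open>{0, i}\<close>, \<open>{i+1, i+3}\<close>, \<open>{i+2, i+6}\<close>, \<open>{i+4, i+5}\<close>.  Up to signs these
  are the unit vectors of \<open>V\<close> placed at \<open>g\<^sub>i\<close>, and the structure map records their brackets.  So the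
  algebra is a product of the abelian ideal \<open>Vg\<^sub>0\<close> and a copy of \<open>so\<^sub>8\<close>, and everything follows from
  the simplicity of \<open>so\<^sub>n\<close> for \<open>n \<ge> 5\<close>.\<close>

section \<open>Simplicity of the orthogonal Lie algebra\<close>

text \<open>A difference of two indicators, rather than a case distinction, makes
  \<open>rot a a = 0\<close> and \<open>rot b a = - rot a b\<close> hold without side
  conditions.\<close>

definition rot :: "'n \<Rightarrow> 'n \<Rightarrow> 'a::field^'n^'n" where
  "rot a b = (\<chi> i j. (if i = a \<and> j = b then 1 else 0) - (if i = b \<and> j = a then 1 else 0))"

lemma mat_scale_nth [simp]: "mat_scale c A $ i $ j = c * A $ i $ j"
  by (simp add: mat_scale_def map_matrix_def)

lemma vector_space_mat_scale: "vector_space (mat_scale :: 'a::field \<Rightarrow> 'a^'n^'n \<Rightarrow> _)"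
  using lie_algebra_gl lie_algebra_def by blast

lemma mat_br_nth:
  "mat_br A B $ i $ j = (\<Sum>k\<in>UNIV. A $ i $ k * B $ k $ j) - (\<Sum>k\<in>UNIV. B $ i $ k * A $ k $ j)"
  by (simp add: mat_br_def matrix_matrix_mult_def)

text \<open>Forward, the form identity is tested on pairs of unit vectors. Backward, skewness of the
  entries is used after exchanging the two sums.\<close>

lemma so_mat_iff_skew:
  fixes A :: "'a::field^'n^'n"
  shows "A \<in> so_mat \<longleftrightarrow> (\<forall>i j. A $ j $ i = - A $ i $ j)"
proof
  assume A: "A \<in> so_mat"
  have *: "std_form (A *v axis i 1) (axis j 1) = A $ j $ i" "std_form (axis i 1) (A *v axis j 1) = A $ i $ j" for i j
    by (simp_all add: std_form_def matrix_vector_mult_def axis_def if_distrib if_distribR cong: if_cong)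
  show "\<forall>i j. A $ j $ i = - A $ i $ j"
  proof (intro allI)
    fix i j
    have "std_form (A *v axis i 1) (axis j 1) + std_form (axis i 1) (A *v axis j 1) = 0"
      using A by (simp add: so_mat_def)
    then show "A $ j $ i = - A $ i $ j" by (simp add: * eq_neg_iff_add_eq_0)
  qed
next
  assume A: "\<forall>i j. A $ j $ i = - A $ i $ j"
  have "std_form (A *v x) y = - std_form x (A *v y)" for x y
  proof -
    have "std_form (A *v x) y = (\<Sum>i\<in>UNIV. \<Sum>j\<in>UNIV. A $ i $ j * x $ j * y $ i)"
      by (simp add: std_form_def matrix_vector_mult_def sum_distrib_right)
    also have "\<dots> = (\<Sum>j\<in>UNIV. \<Sum>i\<in>UNIV. A $ i $ j * x $ j * y $ i)"
      by (rule sum.swap)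
    also have "\<dots> = (\<Sum>j\<in>UNIV. \<Sum>i\<in>UNIV. - (x $ j * (A $ j $ i * y $ i)))"
      by (intro sum.cong refl, subst A[rule_format]) (simp add: mult_ac)
    finally show ?thesis
      by (simp add: std_form_def matrix_vector_mult_def sum_distrib_left sum_negf)
  qed
  then show "A \<in> so_mat" by (simp add: so_mat_def)
qed

lemma so_mat_diag:
  fixes A :: "'a::field^'n^'n"
  assumes "(2::'a) \<noteq> 0" "A \<in> so_mat"
  shows "A $ i $ i = 0"
proof -
  have "A $ i $ i = - A $ i $ i" using assms(2) so_mat_iff_skew by blast
  then have "2 * A $ i $ i = 0" by (simp add: eq_neg_iff_add_eq_0)
  then show ?thesis using assms(1) by simp
qed

lemma rot_in_so: "rot a b \<in> so_mat"
  unfolding so_mat_iff_skew by (simp add: rot_def conj_commute)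

lemma subalgebra_so_mat: "lie_subalgebra mat_scale mat_br (so_mat :: ('a::field^'n^'n) set)"
proof -
  interpret vector_space "mat_scale :: 'a \<Rightarrow> 'a^'n^'n \<Rightarrow> _" by (rule vector_space_mat_scale)
  have "subspace (so_mat :: ('a^'n^'n) set)"
    unfolding subspace_def
  proof (intro conjI allI ballI)
    show "x + y \<in> so_mat" if "x \<in> so_mat" "y \<in> so_mat" for x y :: "'a^'n^'n"
      unfolding so_mat_iff_skew
    proof (intro allI)
      show "(x + y) $ j $ i = - (x + y) $ i $ j" for i j
        using that[unfolded so_mat_iff_skew, rule_format, of j i] by simp
    qed
    show "mat_scale c x \<in> so_mat" if "x \<in> so_mat" for c and x :: "'a^'n^'n"
      unfolding so_mat_iff_skew
    proof (intro allI)
      show "mat_scale c x $ j $ i = - mat_scale c x $ i $ j" for i j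
        using that[unfolded so_mat_iff_skew, rule_format, of j i] by simp
    qed
  qed (simp add: so_mat_iff_skew)
  moreover have "mat_br A B \<in> so_mat" if "A \<in> so_mat" "B \<in> so_mat" for A B :: "'a^'n^'n"
  proof -
    have skew: "A $ i $ j = - A $ j $ i" "B $ i $ j = - B $ j $ i" for i j
      using that unfolding so_mat_iff_skew by blast+
    \<comment> \<open>Two sign changes cancel, so the entry of \<open>A ** B\<close> at (i, j) is
      the entry of \<open>B ** A\<close> at (j, i), which makes the commutator skew.\<close>
    have "A $ i $ k * B $ k $ j = B $ j $ k * A $ k $ i" for i j k
      by (subst skew(1), subst skew(2)) (simp add: mult.commute)
    then show ?thesis unfolding so_mat_iff_skew mat_br_nth by simp
  qed
  ultimately show ?thesis by (simp add: lie_subalgebra_def)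
qed

text \<open>Left multiplication by \<open>rot a b\<close> involves only the rows \<open>a\<close>
  and \<open>b\<close>, right multiplication only the columns. Brackets with \<open>rot a b\<close>
  thus become case distinctions on indices, with no sums left.\<close>

lemma mat_br_rot_nth:
  "mat_br (rot a b) X $ i $ j =
    (if i = a then X $ b $ j else 0) - (if i = b then X $ a $ j else 0)
    - (if j = b then X $ i $ a else 0) + (if j = a then X $ i $ b else 0)"
proof -
  have "rot a b $ i $ k * X $ k $ j = (if k = b then if i = a then X $ k $ j else 0 else 0)
      - (if k = a then if i = b then X $ k $ j else 0 else 0)"
    "X $ i $ k * rot a b $ k $ j = (if k = a then if j = b then X $ i $ k else 0 else 0)
      - (if k = b then if j = a then X $ i $ k else 0 else 0)" for k
    by (auto simp: rot_def)
  then show ?thesis by (simp add: mat_br_nth sum_subtractf)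
qed

text \<open>Up to sign, \<open>(ad (rot a b))\<^sup>2\<close> projects onto the span of the \<open>rot i j\<close> for which
  \<open>{i, j}\<close> meets \<open>{a, b}\<close> in a single point.\<close>

lemma mat_br_rot_twice:
  fixes X :: "'a::field^'n^'n"
  assumes "X \<in> so_mat" "(2::'a) \<noteq> 0" "a \<noteq> b"
  shows "mat_br (rot a b) (mat_br (rot a b) X) $ i $ j =
    (if (i \<in> {a, b}) = (j \<in> {a, b}) then 0 else - X $ i $ j)"
  using assms(3) so_mat_diag[OF assms(2,1)] assms(1)[unfolded so_mat_iff_skew, rule_format, of a b]
  by (auto simp: mat_br_rot_nth)

text \<open>\<open>P a c\<close> followed by \<open>P b d\<close> keeps only the entries joining {a,
  c} to {b, d}. Then \<open>P a f\<close> removes those that involve \<open>c\<close>, and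
  \<open>P b f\<close> removes the pair {a, d}. The four signs multiply to 1. The spare index
  \<open>f\<close> is the source of the bound 5 on the dimension.\<close>

lemma mat_br_rot_isolate:
  fixes X :: "'a::field^'n^'n"
  assumes X: "X \<in> so_mat" and two: "(2::'a) \<noteq> 0" and d: "distinct [a, b, c, d, f]"
  defines "P \<equiv> \<lambda>a b Y. mat_br (rot a b) (mat_br (rot a b) Y)"
  shows "P b f (P a f (P b d (P a c X))) = mat_scale (X $ a $ b) (rot a b)"
proof -
  have so: "P a b Y \<in> so_mat" if "Y \<in> so_mat" for a b and Y :: "'a^'n^'n"
    using that subalgebra_so_mat rot_in_so unfolding P_def lie_subalgebra_def by blast
  have nth: "P a b Y $ i $ j = (if (i \<in> {a, b}) = (j \<in> {a, b}) then 0 else - Y $ i $ j)"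
    if "Y \<in> so_mat" "a \<noteq> b" for a b i j and Y :: "'a^'n^'n"
    unfolding P_def by (rule mat_br_rot_twice[OF that(1) two that(2)])
  have "X $ b $ a = - X $ a $ b" using X so_mat_iff_skew by blast
  then show ?thesis
    using d by (auto simp: vec_eq_iff nth so X rot_def)
qed

lemma mat_br_rot_rot:
  assumes "distinct [a, b, c]"
  shows "mat_br (rot a b) (rot b c) = rot a c"
  using assms by (simp add: vec_eq_iff mat_br_rot_nth) (simp add: rot_def)

lemma ex_distinct_five:
  assumes "CARD('n::finite) \<ge> 5" "a \<noteq> (b::'n)"
  shows "\<exists>c d f. distinct [a, b, c, d, f]"
proof -
  have *: "\<exists>z. z \<notin> set xs" if "length xs < 5" for xs :: "'n list"
  proof (rule ccontr)
    assume "\<not> ?thesis"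
    then have "set xs = UNIV" by auto
    then show False using card_length[of xs] that assms(1) by simp
  qed
  obtain c where c: "c \<notin> {a, b}" using *[of "[a, b]"] by auto
  obtain d where d: "d \<notin> {a, b, c}" using *[of "[a, b, c]"] by auto
  obtain f where "f \<notin> {a, b, c, d}" using *[of "[a, b, c, d]"] by auto
  with c d assms(2) have "distinct [a, b, c, d, f]" by auto
  then show ?thesis by blast
qed

text \<open>The sum runs over ordered pairs, and (a, b) and (b, a) contribute the same matrix; hence
  the factor 1/2.\<close>

lemma so_mat_expand:
  fixes A :: "'a::field^'n^'n"
  assumes "A \<in> so_mat" "(2::'a) \<noteq> 0"
  shows "A = (\<Sum>a\<in>UNIV. \<Sum>b\<in>UNIV. mat_scale (A $ a $ b / 2) (rot a b))"
proof -
  have "(\<Sum>a\<in>UNIV. \<Sum>b\<in>UNIV. mat_scale (A $ a $ b / 2) (rot a b)) $ i $ j = A $ i $ j" for i j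
  proof -
    have "(\<Sum>a\<in>UNIV. \<Sum>b\<in>UNIV. mat_scale (A $ a $ b / 2) (rot a b)) $ i $ j =
      (\<Sum>a\<in>UNIV. \<Sum>b\<in>UNIV. (if b = j then if a = i then A $ a $ b / 2 else 0 else 0)
         - (if b = i then if a = j then A $ a $ b / 2 else 0 else 0))"
      by (auto simp: rot_def intro!: sum.cong)
    also have "\<dots> = A $ i $ j / 2 - A $ j $ i / 2"
      by (simp add: sum_subtractf)
    also have "\<dots> = A $ i $ j"
    proof -
      have "A $ j $ i = - A $ i $ j" using assms(1) so_mat_iff_skew by blast
      moreover have "x / 2 + x / 2 = x" for x :: 'a
        using assms(2) mult_2[of "x / 2", symmetric] by simp
      ultimately show ?thesis by simp
    qed
    finally show ?thesis .
  qed
  then show ?thesis by (simp add: vec_eq_iff)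
qed

text \<open>A nonzero element of an ideal has a nonzero entry at some (a, b), and
  \<open>mat_br_rot_isolate\<close> turns it into \<open>rot a b\<close> inside the ideal. Brackets
  then produce every \<open>rot i j\<close>, and these span.\<close>

theorem so_mat_simple:
  assumes card: "CARD('n::finite) \<ge> 5" and two: "(2::'a::field) \<noteq> 0"
  shows "lie_simple mat_scale mat_br (so_mat :: ('a^'n^'n) set)"
  unfolding lie_simple_def
proof (intro conjI allI impI)
  show "lie_subalgebra mat_scale mat_br (so_mat :: ('a^'n^'n) set)" by (rule subalgebra_so_mat)
  have "card {undefined::'n} < CARD('n)" using card by simp
  then obtain a b :: 'n where "a \<noteq> b" by (metis (full_types) UNIV_eq_I insertCI less_irrefl)
  then obtain c where abc: "distinct [a, b, c]" using ex_distinct_five[OF card] by fastforce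
  have "rot a c $ a $ c \<noteq> (0::'a)" using abc by (simp add: rot_def)
  then have "mat_br (rot a b) (rot b c) \<noteq> (0 :: 'a^'n^'n)"
    by (metis mat_br_rot_rot[OF abc] zero_index)
  then show "\<exists>x\<in>so_mat. \<exists>y\<in>so_mat. mat_br x y \<noteq> (0 :: 'a^'n^'n)" using rot_in_so by blast
next
  fix I :: "('a^'n^'n) set"
  interpret vector_space "mat_scale :: 'a \<Rightarrow> 'a^'n^'n \<Rightarrow> _" by (rule vector_space_mat_scale)
  assume I: "lie_ideal mat_scale mat_br so_mat I"
  then have sub: "I \<subseteq> so_mat" and ss: "subspace I"
    and br: "\<And>a b Y. Y \<in> I \<Longrightarrow> mat_br (rot a b) Y \<in> I"
    by (auto simp: lie_ideal_def rot_in_so)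
  have neg: "rot i j = - rot j i" for i j :: 'n by (simp add: rot_def vec_eq_iff)
  show "I = {0} \<or> I = so_mat"
  proof (cases "I \<subseteq> {0}")
    case True
    then show ?thesis using subspace_0[OF ss] by auto
  next
    case False
    then obtain X where X: "X \<in> I" "X \<noteq> 0" by auto
    then obtain a b where ab: "X $ a $ b \<noteq> 0" by (auto simp: vec_eq_iff)
    have "X \<in> so_mat" using X sub by auto
    then have "a \<noteq> b" using ab so_mat_diag[OF two] by auto
    then obtain c d f where cdf: "distinct [a, b, c, d, f]" using ex_distinct_five[OF card] by blast
    have "mat_scale (X $ a $ b) (rot a b) \<in> I"
      using X(1) unfolding mat_br_rot_isolate[OF \<open>X \<in> so_mat\<close> two cdf, symmetric] by (intro br)
    then have "mat_scale (1 / X $ a $ b) (mat_scale (X $ a $ b) (rot a b)) \<in> I"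
      by (rule subspace_scale[OF ss])
    then have rab: "rot a b \<in> I" using ab by simp
    \<comment> \<open>Bracketing with \<open>rot i j\<close> exchanges the first index; together
      with \<open>sym\<close> below, both indices can be moved.\<close>
    have step: "rot i k \<in> I" if "rot j k \<in> I" "j \<noteq> k" "i \<noteq> k" for i j k
    proof (cases "i = j")
      case False
      then have "(mat_br (rot i j) (rot j k) :: 'a^'n^'n) = rot i k"
        using that by (intro mat_br_rot_rot) auto
      then show ?thesis using br[OF that(1), of i j] by simp
    qed (use that in simp)
    have sym: "rot j i \<in> I" if "rot i j \<in> I" for i j
      using that subspace_neg[OF ss] neg by metis
    have ib: "rot i b \<in> I" if "i \<noteq> b" for i using step[OF rab \<open>a \<noteq> b\<close> that] .
    have "rot i j \<in> I" for i j
    proof -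
      consider "i = j" | "i = b" "i \<noteq> j" | "j = b" "i \<noteq> j" | "i \<noteq> b" "j \<noteq> b" "i \<noteq> j" by blast
      then show ?thesis
      proof cases
        case 1
        then have "rot i j = (0 :: 'a^'n^'n)" by (simp add: rot_def vec_eq_iff)
        then show ?thesis using subspace_0[OF ss] by simp
      next
        case 4
        then show ?thesis using step[OF sym[OF ib[of j]], of i] by simp
      qed (use ib sym in auto)
    qed
    then have "A \<in> I" if "A \<in> so_mat" for A
      by (subst so_mat_expand[OF that two]) (intro subspace_sum[OF ss] subspace_scale[OF ss])
    then show ?thesis using sub by auto
  qed
qed

text \<open>If \<open>X\<close> commutes with every \<open>rot a b\<close>, the innermost bracket in
  \<open>mat_br_rot_isolate\<close> is already zero, so each off-diagonal entry of \<open>X\<close>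
  vanishes.\<close>

lemma so_mat_centralizer_trivial:
  fixes X :: "'a::field^'n^'n"
  assumes "CARD('n) \<ge> 5" "(2::'a) \<noteq> 0" "X \<in> so_mat" "\<And>Y. Y \<in> so_mat \<Longrightarrow> mat_br X Y = 0"
  shows "X = 0"
proof -
  have 0: "mat_br (rot a b) X = 0" for a b
    using assms(4)[OF rot_in_so, of a b] by (simp add: mat_br_def)
  have 1: "mat_br Y 0 = 0" for Y :: "'a^'n^'n" by (simp add: mat_br_nth vec_eq_iff)
  have "X $ a $ b = 0" for a b
  proof (cases "a = b")
    case False
    then obtain c d f where "distinct [a, b, c, d, f]" using ex_distinct_five[OF assms(1)] by blast
    from mat_br_rot_isolate[OF assms(3,2) this]
    have "mat_scale (X $ a $ b) (rot a b) $ a $ b = 0" by (simp add: 0 1)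
    then show ?thesis using False by (simp add: rot_def)
  qed (use so_mat_diag assms in blast)
  then show ?thesis by (simp add: vec_eq_iff)
qed

section \<open>The labels of Z_2^3 and their cyclic indices\<close>

lemma idx_range: "idx n \<in> {1..7}"
  by (auto simp: idx_def)

lemma idx_add_idx: "idx (idx m + k) = idx (m + k)"
proof -
  have "idx m mod 7 = m mod 7" by (simp add: idx_def)
  then have "(idx m + k) mod 7 = (m + k) mod 7" by (rule mod_add_cong) simp
  then show ?thesis unfolding idx_def[of "idx m + k"] idx_def[of "m + k"] by simp
qed

lemma idx_add_7: "idx (m + 7) = idx m"
  by (simp add: idx_def)

lemma atLeast1AtMost7: "{1..7::nat} = {1, 2, 3, 4, 5, 6, 7}"
  by auto

lemma UNIV_Z2_3: "(UNIV :: Z2_3 set) = lab ` {0, 1, 2, 3, 4, 5, 6, 7}"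
proof -
  have "g \<in> lab ` {0, 1, 2, 3, 4, 5, 6, 7}" for g :: Z2_3
    by (cases g; cases "fst g"; cases "fst (snd g)"; cases "snd (snd g)") (simp_all add: lab_def)
  then show ?thesis by auto
qed

lemma finite_Z2_3: "finite (A :: Z2_3 set)"
  by (rule finite_subset[OF subset_UNIV]) (simp add: UNIV_Z2_3)

text \<open>The lines of the Fano plane are {i, i+1, i+3}, so the pairs {i+1, i+3}, {i+2, i+6},
  {i+4, i+5} are the three ways to write g_i as a sum of two other nonzero elements. Listing the
  group relative to \<open>i\<close> lets the coefficient at g_i be computed once for all
  \<open>i\<close>.\<close>

lemma Z2_3_cyclic:
  assumes "i \<in> {1..7}"
  shows "(UNIV :: Z2_3 set) = lab ` {0, i, idx (i+1), idx (i+2), idx (i+3), idx (i+4), idx (i+5), idx (i+6)}"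
    and "distinct (map lab [0, i, idx (i+1), idx (i+2), idx (i+3), idx (i+4), idx (i+5), idx (i+6)])"
    and "lab i - lab (idx (i+1)) = lab (idx (i+3))"
    and "lab i - lab (idx (i+2)) = lab (idx (i+6))"
    and "lab i - lab (idx (i+3)) = lab (idx (i+1))"
    and "lab i - lab (idx (i+4)) = lab (idx (i+5))"
    and "lab i - lab (idx (i+5)) = lab (idx (i+4))"
    and "lab i - lab (idx (i+6)) = lab (idx (i+2))"
proof -
  have 1: "\<forall>i\<in>{1..7}. (UNIV :: Z2_3 set) = lab ` {0, i, idx (i+1), idx (i+2), idx (i+3), idx (i+4), idx (i+5), idx (i+6)}"
    unfolding ball_1_7 UNIV_Z2_3 by (simp add: idx_def insert_commute numeral_2_eq_2)
  show "(UNIV :: Z2_3 set) = lab ` {0, i, idx (i+1), idx (i+2), idx (i+3), idx (i+4), idx (i+5), idx (i+6)}"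
    using 1 assms by blast
  have 2: "\<forall>i\<in>{1..7}. distinct (map lab [0, i, idx (i+1), idx (i+2), idx (i+3), idx (i+4), idx (i+5), idx (i+6)])"
    unfolding ball_1_7 by (simp add: idx_def lab_def)
  show "distinct (map lab [0, i, idx (i+1), idx (i+2), idx (i+3), idx (i+4), idx (i+5), idx (i+6)])"
    using 2 assms by blast
  have 3: "\<forall>i\<in>{1..7}. lab i - lab (idx (i+1)) = lab (idx (i+3))
    \<and> lab i - lab (idx (i+2)) = lab (idx (i+6))
    \<and> lab i - lab (idx (i+3)) = lab (idx (i+1))
    \<and> lab i - lab (idx (i+4)) = lab (idx (i+5))
    \<and> lab i - lab (idx (i+5)) = lab (idx (i+4))
    \<and> lab i - lab (idx (i+6)) = lab (idx (i+2))"
    unfolding ball_1_7 by (simp add: idx_def lab_def zero_prod_def)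
  show "lab i - lab (idx (i+1)) = lab (idx (i+3))"
    and "lab i - lab (idx (i+2)) = lab (idx (i+6))"
    and "lab i - lab (idx (i+3)) = lab (idx (i+1))"
    and "lab i - lab (idx (i+4)) = lab (idx (i+5))"
    and "lab i - lab (idx (i+5)) = lab (idx (i+4))"
    and "lab i - lab (idx (i+6)) = lab (idx (i+2))"
    using 3 assms by blast+
qed

lemma lab_eq_iff:
  assumes "i \<le> 7" "j \<le> 7"
  shows "lab i = lab j \<longleftrightarrow> i = j"
proof -
  have *: "\<forall>i\<in>{0, 1, 2, 3, 4, 5, 6, 7::nat}. \<forall>j\<in>{0, 1, 2, 3, 4, 5, 6, 7}. lab i = lab j \<longrightarrow> i = j"
    by (simp add: lab_def)
  have "i \<in> {0, 1, 2, 3, 4, 5, 6, 7}" "j \<in> {0, 1, 2, 3, 4, 5, 6, 7}"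
    using assms by auto
  then show ?thesis using bspec[OF bspec[OF *], of i j] by auto
qed

lemma Z2_3_cases:
  fixes g :: Z2_3
  obtains "g = lab 0" | i where "i \<in> {1..7}" "g = lab i"
proof -
  have "g \<in> lab ` {0, 1, 2, 3, 4, 5, 6, 7}"
    unfolding UNIV_Z2_3[symmetric] by (rule UNIV_I)
  then consider "g = lab 0" | "g \<in> lab ` {1, 2, 3, 4, 5, 6, 7}" by auto
  then show ?thesis
  proof cases
    case 2
    then obtain i where "i \<in> {1, 2, 3, 4, 5, 6, 7}" "g = lab i" by blast
    then show ?thesis using that(2) unfolding atLeast1AtMost7 by blast
  qed (use that in blast)
qed

lemma poly_mapping_Z2_3_eqI:
  fixes x y :: "Z2_3 \<Rightarrow>\<^sub>0 'b::zero"
  assumes "Poly_Mapping.lookup x (lab 0) = Poly_Mapping.lookup y (lab 0)"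
    "\<And>i. i \<in> {1..7} \<Longrightarrow> Poly_Mapping.lookup x (lab i) = Poly_Mapping.lookup y (lab i)"
  shows "x = y"
  using assms by (intro poly_mapping_eqI) (metis Z2_3_cases)

section \<open>Products in the generalized group algebra\<close>

lemma lookup_gga_scale:
  fixes scl :: "'a::field \<Rightarrow> 'v::ab_group_add \<Rightarrow> 'v"
  assumes "vector_space scl"
  shows "Poly_Mapping.lookup (gga_scale scl c x) g = scl c (Poly_Mapping.lookup x g)"
proof -
  interpret vector_space scl by fact
  show ?thesis by (simp add: gga_scale_def map.rep_eq when_def)
qed

lemma vector_space_gga_scale:
  fixes scl :: "'a::field \<Rightarrow> 'v::ab_group_add \<Rightarrow> 'v"
  assumes "vector_space scl"
  shows "vector_space (gga_scale scl :: 'a \<Rightarrow> ('g \<Rightarrow>\<^sub>0 'v) \<Rightarrow> 'g \<Rightarrow>\<^sub>0 'v)"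
proof -
  interpret vector_space scl by fact
  show ?thesis
    by unfold_locales
      (auto intro!: poly_mapping_eqI simp: lookup_gga_scale[OF assms] lookup_add algebra_simps scale_right_distrib scale_left_distrib)
qed

text \<open>As \<sigma> kills zero arguments, the sums over the supports may run over the whole
  finite group; for each \<open>k\<close>, only \<open>h = g - k\<close> then contributes to degree
  \<open>g\<close>.\<close>

lemma lookup_gga_mult:
  fixes \<sigma> :: "'g::ab_group_add \<Rightarrow> 'g \<Rightarrow> 'v::ab_group_add \<Rightarrow> 'v \<Rightarrow> 'v"
  assumes fin: "finite (UNIV :: 'g set)"
    and zero: "\<And>g h s. \<sigma> g h 0 s = 0" "\<And>g h r. \<sigma> g h r 0 = 0"
  shows "Poly_Mapping.lookup (gga_mult \<sigma> x y) g =
    (\<Sum>h\<in>UNIV. \<sigma> h (g - h) (Poly_Mapping.lookup x h) (Poly_Mapping.lookup y (g - h)))"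
proof -
  have "gga_mult \<sigma> x y = (\<Sum>g\<in>UNIV. \<Sum>h\<in>Poly_Mapping.keys y.
      Poly_Mapping.single (g + h) (\<sigma> g h (Poly_Mapping.lookup x g) (Poly_Mapping.lookup y h)))"
    unfolding gga_mult_def
    by (rule sum.mono_neutral_left[OF fin]) (auto simp: zero in_keys_iff)
  also have "\<dots> = (\<Sum>g\<in>UNIV. \<Sum>h\<in>UNIV.
      Poly_Mapping.single (g + h) (\<sigma> g h (Poly_Mapping.lookup x g) (Poly_Mapping.lookup y h)))"
    by (intro sum.cong refl sum.mono_neutral_left[OF fin]) (auto simp: zero in_keys_iff)
  finally have "Poly_Mapping.lookup (gga_mult \<sigma> x y) g = (\<Sum>k\<in>UNIV. \<Sum>h\<in>UNIV.
      \<sigma> k h (Poly_Mapping.lookup x k) (Poly_Mapping.lookup y h) when k + h = g)"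
    by (simp add: lookup_sum lookup_single)
  also have "\<dots> = (\<Sum>k\<in>UNIV. \<Sum>h\<in>UNIV.
      if h = g - k then \<sigma> k h (Poly_Mapping.lookup x k) (Poly_Mapping.lookup y h) else 0)"
    by (intro sum.cong refl) (auto simp: when_def algebra_simps)
  also have "\<dots> = (\<Sum>h\<in>UNIV. \<sigma> h (g - h) (Poly_Mapping.lookup x h) (Poly_Mapping.lookup y (g - h)))"
    using fin by simp
  finally show ?thesis .
qed

text \<open>The number in the name is the residue of j - i modulo 7 at which this map occurs. Taking
  coordinates by projection allows equations between functions, without arguments in
  \<open>vector\<close> form; the same holds for the next two maps.\<close>

definition sigma1 :: "'a::field^4 \<Rightarrow> 'a^4 \<Rightarrow> 'a^4" where
  "sigma1 a b = vector [- a$2 * b$1 - a$3 * b$3, - a$2 * b$3 - a$3 * b$1,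
     a$1 * b$2 + a$4 * b$4, a$1 * b$4 + a$4 * b$2]"

definition sigma2 :: "'a::field^4 \<Rightarrow> 'a^4 \<Rightarrow> 'a^4" where
  "sigma2 a b = vector [a$2 * b$3 + a$4 * b$4, - a$1 * b$1 - a$3 * b$2,
     - a$1 * b$2 - a$3 * b$1, a$2 * b$4 + a$4 * b$3]"

definition sigma4 :: "'a::field^4 \<Rightarrow> 'a^4 \<Rightarrow> 'a^4" where
  "sigma4 a b = vector [- a$1 * b$2 - a$2 * b$3, a$3 * b$1 + a$4 * b$4,
     - a$1 * b$3 - a$2 * b$2, a$3 * b$4 + a$4 * b$1]"

lemma vector_4_eta: "vector [r$1, r$2, r$3, r$4] = (r :: 'a::zero^4)"
  by (simp add: vec_eq_iff forall_4 vector_4)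

section \<open>Coefficients of the bracket for a given structure map\<close>

locale structure_map =
  fixes \<sigma> :: "Z2_3 \<Rightarrow> Z2_3 \<Rightarrow> 'a::field^4 \<Rightarrow> 'a^4 \<Rightarrow> 'a^4"
  assumes structure_map: "is_structure_map \<sigma>"
begin

lemma bil: "bil_map (*s) (\<sigma> g h)"
  using structure_map unfolding is_structure_map_def by blast

lemma sigma_linear:
  "\<sigma> g h (r + r') s = \<sigma> g h r s + \<sigma> g h r' s" "\<sigma> g h r (s + s') = \<sigma> g h r s + \<sigma> g h r s'"
  "\<sigma> g h (c *s r) s = c *s \<sigma> g h r s" "\<sigma> g h r (c *s s) = c *s \<sigma> g h r s"
  using bil[of g h] by (simp_all add: bil_map_def Vector_Spaces.linear_iff)

lemma sigma_zero: "\<sigma> g h 0 s = 0" "\<sigma> g h r 0 = 0"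
  using sigma_linear(3)[of g h 0 0 s] sigma_linear(4)[of g h r 0 0] by simp_all

lemma sigma_lab_base:
  assumes i: "i \<in> {1..7}"
  shows "\<sigma> (lab i) (lab (idx (i + 1))) = sigma1"
    "\<sigma> (lab i) (lab (idx (i + 2))) = sigma2"
    "\<sigma> (lab i) (lab (idx (i + 4))) = sigma4"
proof -
  have "\<forall>a1 a2 a3 a4 b1 b2 b3 b4.
    \<sigma> (lab i) (lab (idx (i + 1))) (vector [a1, a2, a3, a4]) (vector [b1, b2, b3, b4]) =
      sigma1 (vector [a1, a2, a3, a4]) (vector [b1, b2, b3, b4]) \<and>
    \<sigma> (lab i) (lab (idx (i + 2))) (vector [a1, a2, a3, a4]) (vector [b1, b2, b3, b4]) =
      sigma2 (vector [a1, a2, a3, a4]) (vector [b1, b2, b3, b4]) \<and>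
    \<sigma> (lab i) (lab (idx (i + 4))) (vector [a1, a2, a3, a4]) (vector [b1, b2, b3, b4]) =
      sigma4 (vector [a1, a2, a3, a4]) (vector [b1, b2, b3, b4])"
    using structure_map i
    unfolding is_structure_map_def sigma1_def sigma2_def sigma4_def vector_4 by blast
  \<comment> \<open>By \<open>vector_4_eta\<close>, arbitrary \<open>r\<close> and \<open>s\<close>
    have the \<open>vector\<close> form for which the clauses are stated.\<close>
  then have *: "\<sigma> (lab i) (lab (idx (i + 1))) r s = sigma1 r s"
    "\<sigma> (lab i) (lab (idx (i + 2))) r s = sigma2 r s"
    "\<sigma> (lab i) (lab (idx (i + 4))) r s = sigma4 r s" for r s
    by (metis vector_4_eta)+
  show "\<sigma> (lab i) (lab (idx (i + 1))) = sigma1"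
    "\<sigma> (lab i) (lab (idx (i + 2))) = sigma2"
    "\<sigma> (lab i) (lab (idx (i + 4))) = sigma4"
    by (intro ext; simp only: *)+
qed

lemma sigma_lab_opposite:
  assumes i: "i \<in> {1..7}"
  shows "\<sigma> (lab i) (lab i) r s = 0"
    "\<sigma> (lab i) (lab (idx (i + 3))) r s = - sigma4 s r"
    "\<sigma> (lab i) (lab (idx (i + 5))) r s = - sigma2 s r"
    "\<sigma> (lab i) (lab (idx (i + 6))) r s = - sigma1 s r"
    "\<sigma> (lab 0) (lab i) r s = 0" "\<sigma> (lab i) (lab 0) r s = 0"
  using structure_map i sigma_lab_base[OF i] by (simp_all add: is_structure_map_def)

lemma sigma_00: "\<sigma> (lab 0) (lab 0) r s = 0"
  using structure_map by (simp add: is_structure_map_def)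

text \<open>Every element of the group is its own inverse, so only pairs of equal degrees reach
  degree 0, and there \<sigma> vanishes.\<close>

lemma lookup_bracket_0: "Poly_Mapping.lookup (gga_mult \<sigma> x y) (lab 0) = 0"
proof -
  have "\<sigma> h (lab 0 - h) r s = 0" for h r s
  proof (cases h rule: Z2_3_cases)
    case (2 i)
    have "\<forall>i\<in>{1..7}. lab 0 - lab i = lab i"
      unfolding ball_1_7 by (simp add: lab_def zero_prod_def)
    then show ?thesis using 2 sigma_lab_opposite(1) by simp
  next
    case 1
    moreover have "lab 0 - lab 0 = lab 0" by (simp add: lab_def zero_prod_def)
    ultimately show ?thesis by (simp only: sigma_00)
  qed
  then show ?thesis
    by (simp add: lookup_gga_mult finite_Z2_3 sigma_zero)
qed

text \<open>One difference arises for each line through g_i. The pairs (i+4, i+5), (i+1, i+3), (i+2,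
  i+6) are ordered so that their index differences are 1, 2, 4; the reversed pairs give the negative
  terms. Terms that involve g_0 vanish.\<close>

lemma lookup_bracket:
  fixes x y :: "Z2_3 \<Rightarrow>\<^sub>0 'a^4"
  assumes i: "i \<in> {1..7}"
  defines "X \<equiv> \<lambda>k. Poly_Mapping.lookup x (lab (idx (i + k)))"
    and "Y \<equiv> \<lambda>k. Poly_Mapping.lookup y (lab (idx (i + k)))"
  shows "Poly_Mapping.lookup (gga_mult \<sigma> x y) (lab i) =
    sigma1 (X 4) (Y 5) - sigma1 (Y 4) (X 5) + sigma2 (X 1) (Y 3) - sigma2 (Y 1) (X 3)
    + sigma4 (X 2) (Y 6) - sigma4 (Y 2) (X 6)"
proof -
  note base = sigma_lab_base[OF idx_range, unfolded idx_add_idx]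
    and opp = sigma_lab_opposite(2-4)[OF idx_range, unfolded idx_add_idx]
  \<comment> \<open>The reversed pairs have differences 6, 5 and 3, and their second indices i+11,
    i+8 and i+9 wrap around to i+4, i+1 and i+2.\<close>
  have s: "\<sigma> (lab (idx (i+4))) (lab (idx (i+5))) = sigma1" "\<sigma> (lab (idx (i+1))) (lab (idx (i+3))) = sigma2"
    "\<sigma> (lab (idx (i+2))) (lab (idx (i+6))) = sigma4"
    "\<sigma> (lab (idx (i+5))) (lab (idx (i+4))) r s = - sigma1 s r"
    "\<sigma> (lab (idx (i+3))) (lab (idx (i+1))) r s = - sigma2 s r"
    "\<sigma> (lab (idx (i+6))) (lab (idx (i+2))) r s = - sigma4 s r" for r s
    using base(1)[of "i+4"] base(2)[of "i+1"] base(3)[of "i+2"]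
      opp(1)[of "i+6"] opp(2)[of "i+3"] opp(3)[of "i+5"]
      idx_add_7[of "i+4"] idx_add_7[of "i+1"] idx_add_7[of "i+2"] by (simp_all add: numeral_eq_Suc)
  have "Poly_Mapping.lookup (gga_mult \<sigma> x y) (lab i) =
    (\<Sum>h\<in>set (map lab [0, i, idx (i+1), idx (i+2), idx (i+3), idx (i+4), idx (i+5), idx (i+6)]).
      \<sigma> h (lab i - h) (Poly_Mapping.lookup x h) (Poly_Mapping.lookup y (lab i - h)))"
    using Z2_3_cyclic(1)[OF i] by (simp add: lookup_gga_mult finite_Z2_3 sigma_zero)
  \<comment> \<open>Since the eight labels are distinct, a sum over a list replaces the sum over a
    set and unfolds term by term while \<open>i\<close> remains a variable.\<close>
  also have "\<dots> = sum_list (map (\<lambda>h. \<sigma> h (lab i - h) (Poly_Mapping.lookup x h) (Poly_Mapping.lookup y (lab i - h)))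
      (map lab [0, i, idx (i+1), idx (i+2), idx (i+3), idx (i+4), idx (i+5), idx (i+6)]))"
    by (rule sum_list_distinct_conv_sum_set[symmetric]) (rule Z2_3_cyclic(2)[OF i])
  also have "\<dots> = sigma1 (X 4) (Y 5) - sigma1 (Y 4) (X 5) + sigma2 (X 1) (Y 3) - sigma2 (Y 1) (X 3)
    + sigma4 (X 2) (Y 6) - sigma4 (Y 2) (X 6)"
  proof -
    have "lab i - lab 0 = lab i" "lab i - lab i = lab 0" by (simp_all add: lab_def zero_prod_def)
    then show ?thesis
      by (simp only: list.map sum_list.Cons sum_list.Nil Z2_3_cyclic(3-8)[OF i] sigma_lab_opposite(5,6)[OF i] s)
        (simp add: X_def Y_def)
  qed
  finally show ?thesis .
qed

end

section \<open>The isomorphism with the orthogonal Lie algebra\<close>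

lemma UNIV_8: "(UNIV :: 8 set) = {0, 1, 2, 3, 4, 5, 6, 7}"
proof -
  have "x \<in> {0, 1, 2, 3, 4, 5, 6, 7}" for x :: 8
  proof (induct x)
    case (of_int z)
    then have "z = 0 \<or> z = 1 \<or> z = 2 \<or> z = 3 \<or> z = 4 \<or> z = 5 \<or> z = 6 \<or> z = 7" by fastforce
    then show ?case by auto
  qed
  then show ?thesis by auto
qed

lemma sum_8: "sum f (UNIV :: 8 set) = f 0 + f 1 + f 2 + f 3 + f 4 + f 5 + f 6 + f 7"
  unfolding UNIV_8 by (simp add: ac_simps)

lemma forall_8: "(\<forall>x :: 8. P x) \<longleftrightarrow> P 0 \<and> P 1 \<and> P 2 \<and> P 3 \<and> P 4 \<and> P 5 \<and> P 6 \<and> P 7"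
proof -
  have "(\<forall>x :: 8. P x) \<longleftrightarrow> (\<forall>x\<in>{0, 1, 2, 3, 4, 5, 6, 7}. P x)"
    unfolding UNIV_8[symmetric] by simp
  then show ?thesis by simp
qed

text \<open>The reduction modulo 7 takes place in \<open>nat\<close>, before the cast, because
  arithmetic in the type \<open>8\<close> is modulo 8.\<close>

abbreviation ix :: "nat \<Rightarrow> 8" where "ix n \<equiv> of_nat (idx n)"

text \<open>The coefficient at \<open>lab 0\<close> is dropped, so that the kernel is the copy of V
  in degree 0. The minus signs, relative to the chosen orderings of the pairs, adapt the brackets to
  the signs in the structure map.\<close>

definition so8_map :: "(Z2_3 \<Rightarrow>\<^sub>0 'a::field^4) \<Rightarrow> 'a^8^8" where
  "so8_map x = (\<Sum>i\<in>{1..7}. let r = Poly_Mapping.lookup x (lab i) in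
     mat_scale (r$4) (rot 0 (ix i)) - mat_scale (r$1) (rot (ix (i + 1)) (ix (i + 3)))
     - mat_scale (r$2) (rot (ix (i + 2)) (ix (i + 6))) - mat_scale (r$3) (rot (ix (i + 4)) (ix (i + 5))))"

definition so8_inv :: "'a::field^8^8 \<Rightarrow> (Z2_3 \<Rightarrow>\<^sub>0 'a^4)" where
  "so8_inv A = (\<Sum>i\<in>{1..7}. Poly_Mapping.single (lab i) (vector
     [- A $ ix (i + 1) $ ix (i + 3), - A $ ix (i + 2) $ ix (i + 6), - A $ ix (i + 4) $ ix (i + 5),
      A $ 0 $ ix i]))"

lemma lookup_so8_inv:
  "i \<in> {1..7} \<Longrightarrow> Poly_Mapping.lookup (so8_inv A) (lab i) = vector
     [- A $ ix (i + 1) $ ix (i + 3), - A $ ix (i + 2) $ ix (i + 6), - A $ ix (i + 4) $ ix (i + 5), A $ 0 $ ix i]"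
  "Poly_Mapping.lookup (so8_inv A) (lab 0) = 0"
proof -
  let ?v = "\<lambda>i. vector
     [- A $ ix (i + 1) $ ix (i + 3), - A $ ix (i + 2) $ ix (i + 6), - A $ ix (i + 4) $ ix (i + 5), A $ 0 $ ix i] :: 'a^4"
  have *: "Poly_Mapping.lookup (so8_inv A) (lab i) = (\<Sum>j\<in>{1..7}. if j = i then ?v j else 0)" if "i \<le> 7" for i
    unfolding so8_inv_def lookup_sum lookup_single
    by (intro sum.cong refl) (use that in \<open>simp add: when_def lab_eq_iff\<close>)
  show "i \<in> {1..7} \<Longrightarrow> Poly_Mapping.lookup (so8_inv A) (lab i) = ?v i"
    by (subst *) auto
  show "Poly_Mapping.lookup (so8_inv A) (lab 0) = 0"
    by (subst *) auto
qed

lemma so8_map_in_so: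
  fixes x :: "Z2_3 \<Rightarrow>\<^sub>0 'a::field^4"
  shows "so8_map x \<in> so_mat"
proof -
  interpret vector_space "mat_scale :: 'a \<Rightarrow> 'a^8^8 \<Rightarrow> _" by (rule vector_space_mat_scale)
  have "subspace (so_mat :: ('a^8^8) set)"
    by (rule subalgebra_so_mat[unfolded lie_subalgebra_def, THEN conjunct1])
  then show ?thesis
    unfolding so8_map_def Let_def
    by (intro subspace_sum subspace_diff subspace_scale rot_in_so)
qed

text \<open>The four families of pairs, over all seven \<open>i\<close>, contain each two-element
  subset of {0, ..., 7} exactly once, so a single \<open>rot\<close> contributes to each of these
  entries.\<close>

lemma so8_map_nth:
  fixes x :: "Z2_3 \<Rightarrow>\<^sub>0 'a::field^4"
  assumes "i \<in> {1..7}"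
  shows "so8_map x $ 0 $ ix i = Poly_Mapping.lookup x (lab i) $ 4"
    "so8_map x $ ix (i + 1) $ ix (i + 3) = - Poly_Mapping.lookup x (lab i) $ 1"
    "so8_map x $ ix (i + 2) $ ix (i + 6) = - Poly_Mapping.lookup x (lab i) $ 2"
    "so8_map x $ ix (i + 4) $ ix (i + 5) = - Poly_Mapping.lookup x (lab i) $ 3"
proof -
  have "\<forall>i\<in>{1..7}. so8_map x $ 0 $ ix i = Poly_Mapping.lookup x (lab i) $ 4"
    unfolding ball_1_7 so8_map_def atLeast1AtMost7 by (simp add: Let_def rot_def idx_def)
  then show "so8_map x $ 0 $ ix i = Poly_Mapping.lookup x (lab i) $ 4" using assms by blast
  have "\<forall>i\<in>{1..7}. so8_map x $ ix (i + 1) $ ix (i + 3) = - Poly_Mapping.lookup x (lab i) $ 1"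
    unfolding ball_1_7 so8_map_def atLeast1AtMost7 by (simp add: Let_def rot_def idx_def)
  then show "so8_map x $ ix (i + 1) $ ix (i + 3) = - Poly_Mapping.lookup x (lab i) $ 1" using assms by blast
  have "\<forall>i\<in>{1..7}. so8_map x $ ix (i + 2) $ ix (i + 6) = - Poly_Mapping.lookup x (lab i) $ 2"
    unfolding ball_1_7 so8_map_def atLeast1AtMost7 by (simp add: Let_def rot_def idx_def)
  then show "so8_map x $ ix (i + 2) $ ix (i + 6) = - Poly_Mapping.lookup x (lab i) $ 2" using assms by blast
  have "\<forall>i\<in>{1..7}. so8_map x $ ix (i + 4) $ ix (i + 5) = - Poly_Mapping.lookup x (lab i) $ 3"
    unfolding ball_1_7 so8_map_def atLeast1AtMost7 by (simp add: Let_def rot_def idx_def)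
  then show "so8_map x $ ix (i + 4) $ ix (i + 5) = - Poly_Mapping.lookup x (lab i) $ 3" using assms by blast
qed

text \<open>The 4 * 7 = 28 given positions meet every two-element subset of the indices. Skewness
  yields the transposed positions, and the diagonals vanish because 2 is invertible.\<close>

lemma so8_eqI:
  fixes A B :: "'a::field^8^8"
  assumes two: "(2::'a) \<noteq> 0" and so: "A \<in> so_mat" "B \<in> so_mat"
    and eq: "\<And>i. i \<in> {1..7} \<Longrightarrow> A $ 0 $ ix i = B $ 0 $ ix i"
      "\<And>i. i \<in> {1..7} \<Longrightarrow> A $ ix (i + 1) $ ix (i + 3) = B $ ix (i + 1) $ ix (i + 3)"
      "\<And>i. i \<in> {1..7} \<Longrightarrow> A $ ix (i + 2) $ ix (i + 6) = B $ ix (i + 2) $ ix (i + 6)"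
      "\<And>i. i \<in> {1..7} \<Longrightarrow> A $ ix (i + 4) $ ix (i + 5) = B $ ix (i + 4) $ ix (i + 5)"
  shows "A = B"
proof -
  let ?E = "\<lambda>p q. A $ p $ q = B $ p $ q"
  have sym: "?E q p" if "?E p q" for p q
    using that so[unfolded so_mat_iff_skew, rule_format] by metis
  have diag: "?E p p" for p
    using so_mat_diag[OF two so(1)] so_mat_diag[OF two so(2)] by simp
  have "\<forall>i\<in>{1..7}. ?E 0 (ix i) \<and> ?E (ix (i + 1)) (ix (i + 3)) \<and> ?E (ix (i + 2)) (ix (i + 6))
      \<and> ?E (ix (i + 4)) (ix (i + 5))"
    using eq by blast
  then have E: "?E 0 1" "?E 0 2" "?E 0 3" "?E 0 4" "?E 0 5" "?E 0 6" "?E 0 7"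
    "?E 2 4" "?E 3 5" "?E 4 6" "?E 5 7" "?E 6 1" "?E 7 2" "?E 1 3"
    "?E 3 7" "?E 4 1" "?E 5 2" "?E 6 3" "?E 7 4" "?E 1 5" "?E 2 6"
    "?E 5 6" "?E 6 7" "?E 7 1" "?E 1 2" "?E 2 3" "?E 3 4" "?E 4 5"
    unfolding ball_1_7 by (simp_all add: idx_def)
  show ?thesis
    unfolding vec_eq_iff forall_8 by (simp add: E E[THEN sym] diag)
qed

lemma so8_map_inv:
  fixes A :: "'a::field^8^8"
  assumes "(2::'a) \<noteq> 0" "A \<in> so_mat"
  shows "so8_map (so8_inv A) = A"
  by (rule so8_eqI[OF assms(1) so8_map_in_so assms(2)])
    (simp_all only: so8_map_nth lookup_so8_inv vector_4 minus_minus)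

text \<open>The map forgets only the coefficient at g_0, so agreement there restores injectivity. In
  this form it serves both the Jacobi identity and the isomorphism.\<close>

lemma so8_map_inj:
  assumes "so8_map x = so8_map y" "Poly_Mapping.lookup x (lab 0) = Poly_Mapping.lookup y (lab 0)"
  shows "x = y"
proof (rule poly_mapping_Z2_3_eqI[OF assms(2)])
  show "Poly_Mapping.lookup x (lab i) = Poly_Mapping.lookup y (lab i)" if "i \<in> {1..7}" for i
    using so8_map_nth[OF that, of x] so8_map_nth[OF that, of y]
    by (simp add: assms(1) vec_eq_iff forall_4)
qed

lemma so8_map_add: "so8_map (x + y) = so8_map x + so8_map y"
  by (simp add: so8_map_def lookup_add Let_def sum.distrib[symmetric] vec_eq_iff)
    (auto intro!: sum.cong simp: algebra_simps)

lemma so8_map_scale: "so8_map (gga_scale (*s) c x) = mat_scale c (so8_map x)"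
  by (simp add: so8_map_def lookup_gga_scale[OF vec.vector_space_axioms] Let_def sum_distrib_left vec_eq_iff)
    (auto intro!: sum.cong simp: algebra_simps)

lemma so8_map_eq_0_iff: "so8_map x = 0 \<longleftrightarrow> (\<forall>i\<in>{1..7}. Poly_Mapping.lookup x (lab i) = 0)"
proof
  assume "so8_map x = 0"
  then show "\<forall>i\<in>{1..7}. Poly_Mapping.lookup x (lab i) = 0"
    using so8_map_nth[of _ x] by (auto simp: vec_eq_iff forall_4)
qed (simp add: so8_map_def Let_def vec_eq_iff)

context structure_map
begin

text \<open>Both sides are skew, so by \<open>so8_eqI\<close> it suffices to compare 28 entries.
  Each comparison is a polynomial identity between \<open>lookup_bracket\<close> and a difference of
  two eight-term sums.\<close>

lemma so8_map_bracket:
  assumes two: "(2::'a) \<noteq> 0"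
  shows "so8_map (gga_mult \<sigma> x y) = mat_br (so8_map x) (so8_map y)"
proof -
  let ?X = "so8_map x" and ?Y = "so8_map y" and ?Z = "so8_map (gga_mult \<sigma> x y)"
  let ?x = "\<lambda>i. Poly_Mapping.lookup x (lab i)" and ?y = "\<lambda>i. Poly_Mapping.lookup y (lab i)"
  have br: "mat_br ?X ?Y \<in> so_mat"
    using subalgebra_so_mat so8_map_in_so unfolding lie_subalgebra_def by blast
  have entry: "\<forall>i\<in>{1..7}. so8_map z $ 0 $ ix i = f i $ 4
      \<and> so8_map z $ ix (i + 1) $ ix (i + 3) = - f i $ 1
      \<and> so8_map z $ ix (i + 2) $ ix (i + 6) = - f i $ 2
      \<and> so8_map z $ ix (i + 4) $ ix (i + 5) = - f i $ 3"
    if "f = (\<lambda>i. Poly_Mapping.lookup z (lab i))" for f and z :: "Z2_3 \<Rightarrow>\<^sub>0 'a^4"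
    using so8_map_nth[of _ z] that by blast
  have entries: "so8_map z $ 0 $ 1 = f 1 $ 4" "so8_map z $ 0 $ 2 = f 2 $ 4" "so8_map z $ 0 $ 3 = f 3 $ 4"
    "so8_map z $ 0 $ 4 = f 4 $ 4" "so8_map z $ 0 $ 5 = f 5 $ 4" "so8_map z $ 0 $ 6 = f 6 $ 4" "so8_map z $ 0 $ 7 = f 7 $ 4"
    "so8_map z $ 2 $ 4 = - f 1 $ 1" "so8_map z $ 3 $ 5 = - f 2 $ 1" "so8_map z $ 4 $ 6 = - f 3 $ 1"
    "so8_map z $ 5 $ 7 = - f 4 $ 1" "so8_map z $ 6 $ 1 = - f 5 $ 1" "so8_map z $ 7 $ 2 = - f 6 $ 1" "so8_map z $ 1 $ 3 = - f 7 $ 1"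
    "so8_map z $ 3 $ 7 = - f 1 $ 2" "so8_map z $ 4 $ 1 = - f 2 $ 2" "so8_map z $ 5 $ 2 = - f 3 $ 2"
    "so8_map z $ 6 $ 3 = - f 4 $ 2" "so8_map z $ 7 $ 4 = - f 5 $ 2" "so8_map z $ 1 $ 5 = - f 6 $ 2" "so8_map z $ 2 $ 6 = - f 7 $ 2"
    "so8_map z $ 5 $ 6 = - f 1 $ 3" "so8_map z $ 6 $ 7 = - f 2 $ 3" "so8_map z $ 7 $ 1 = - f 3 $ 3"
    "so8_map z $ 1 $ 2 = - f 4 $ 3" "so8_map z $ 2 $ 3 = - f 5 $ 3" "so8_map z $ 3 $ 4 = - f 6 $ 3" "so8_map z $ 4 $ 5 = - f 7 $ 3"
    if "f = (\<lambda>i. Poly_Mapping.lookup z (lab i))" for f and z :: "Z2_3 \<Rightarrow>\<^sub>0 'a^4"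
    using entry[OF that] unfolding ball_1_7 by (simp_all add: idx_def)
  \<comment> \<open>The matrix products also meet the transposed positions, whose values are derived
    from \<open>entries\<close>.\<close>
  have skew: "so8_map z $ p $ q = - c" if "so8_map z $ q $ p = c" for p q c and z :: "Z2_3 \<Rightarrow>\<^sub>0 'a^4"
    using so8_map_in_so[of z, unfolded so_mat_iff_skew, rule_format, of p q] by (simp only: that)
  \<comment> \<open>Opaque names for the coefficient functions turn the goals below into identities
    in the coordinates of \<open>f\<close> and \<open>g\<close>.\<close>
  obtain f g h where f: "f = ?x" and g: "g = ?y"
    and h: "h = (\<lambda>i. Poly_Mapping.lookup (gga_mult \<sigma> x y) (lab i))" by blast
  note E = entries[OF h] entries[OF f] entries[OF g] entries[OF f, THEN skew, unfolded minus_minus]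
    entries[OF g, THEN skew, unfolded minus_minus] so_mat_diag[OF two so8_map_in_so]
  have L: "h i =
    sigma1 (f (idx (i+4))) (g (idx (i+5))) - sigma1 (g (idx (i+4))) (f (idx (i+5)))
    + sigma2 (f (idx (i+1))) (g (idx (i+3))) - sigma2 (g (idx (i+1))) (f (idx (i+3)))
    + sigma4 (f (idx (i+2))) (g (idx (i+6))) - sigma4 (g (idx (i+2))) (f (idx (i+6)))" if "i \<in> {1..7}" for i
    using lookup_bracket[OF that, of x y] by (simp add: f g h)
  note sig = sigma1_def sigma2_def sigma4_def vector_4
  have 1: "\<forall>i\<in>{1..7}. ?Z $ 0 $ ix i = mat_br ?X ?Y $ 0 $ ix i"
    unfolding mat_br_nth sum_8 ball_1_7
    by (simp add: E L sig idx_def algebra_simps numeral_2_eq_2)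
  have 2: "\<forall>i\<in>{1..7}. ?Z $ ix (i + 1) $ ix (i + 3) = mat_br ?X ?Y $ ix (i + 1) $ ix (i + 3)"
    unfolding mat_br_nth sum_8 ball_1_7
    by (simp add: E L sig idx_def algebra_simps numeral_2_eq_2)
  have 3: "\<forall>i\<in>{1..7}. ?Z $ ix (i + 2) $ ix (i + 6) = mat_br ?X ?Y $ ix (i + 2) $ ix (i + 6)"
    unfolding mat_br_nth sum_8 ball_1_7
    by (simp add: E L sig idx_def algebra_simps numeral_2_eq_2)
  have 4: "\<forall>i\<in>{1..7}. ?Z $ ix (i + 4) $ ix (i + 5) = mat_br ?X ?Y $ ix (i + 4) $ ix (i + 5)"
    unfolding mat_br_nth sum_8 ball_1_7
    by (simp add: E L sig idx_def algebra_simps numeral_2_eq_2)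
  show ?thesis
    by (rule so8_eqI[OF two so8_map_in_so br]) (use 1 2 3 4 in blast)+
qed

end

section \<open>Simplicity, derived algebra and center\<close>

text \<open>The isomorphism maps ideals of \<open>S\<close> to ideals of \<open>T\<close>, and its
  injectivity on \<open>S\<close> pulls back the equality of an image with {0} or with
  \<open>T\<close>.\<close>

lemma lie_simple_transfer:
  assumes vs: "vector_space scl" "vector_space scl'"
    and iso: "lie_isomorphic scl br S scl' br' T"
    and sub: "lie_subalgebra scl br S" and simple: "lie_simple scl' br' T"
  shows "lie_simple scl br S"
proof -
  interpret A: vector_space scl by (rule vs)
  interpret B: vector_space scl' by (rule vs)
  obtain \<phi> where bij: "bij_betw \<phi> S T"
    and add: "\<And>x y. x \<in> S \<Longrightarrow> y \<in> S \<Longrightarrow> \<phi> (x + y) = \<phi> x + \<phi> y"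
    and scale: "\<And>c x. x \<in> S \<Longrightarrow> \<phi> (scl c x) = scl' c (\<phi> x)"
    and br: "\<And>x y. x \<in> S \<Longrightarrow> y \<in> S \<Longrightarrow> \<phi> (br x y) = br' (\<phi> x) (\<phi> y)"
    using iso unfolding lie_isomorphic_def by blast
  have inj: "inj_on \<phi> S" and T: "T = \<phi> ` S"
    using bij by (auto simp: bij_betw_def)
  have S: "A.subspace S" "\<And>x y. x \<in> S \<Longrightarrow> y \<in> S \<Longrightarrow> br x y \<in> S"
    using sub by (auto simp: lie_subalgebra_def)
  have 0: "0 \<in> S" using S(1) by (rule A.subspace_0)
  have \<phi>0: "\<phi> 0 = 0" using add[OF 0 0] by simp
  have "I = {0} \<or> I = S" if I: "lie_ideal scl br S I" for I
  proof -
    have IS: "I \<subseteq> S" and Isub: "A.subspace I" and Ibr: "\<And>x y. x \<in> S \<Longrightarrow> y \<in> I \<Longrightarrow> br x y \<in> I"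
      using I by (auto simp: lie_ideal_def)
    have "lie_ideal scl' br' T (\<phi> ` I)"
      unfolding lie_ideal_def
    proof (intro conjI ballI)
      show "\<phi> ` I \<subseteq> T" using IS T by auto
      show "B.subspace (\<phi> ` I)"
      proof (rule B.subspaceI)
        show "0 \<in> \<phi> ` I" using \<phi>0 A.subspace_0[OF Isub] by force
        show "u + v \<in> \<phi> ` I" if uv: "u \<in> \<phi> ` I" "v \<in> \<phi> ` I" for u v
        proof -
          from uv obtain x y where "x \<in> I" "y \<in> I" "u = \<phi> x" "v = \<phi> y" by blast
          then have "u + v = \<phi> (x + y)" "x + y \<in> I"
            using add[of x y] subsetD[OF IS] A.subspace_add[OF Isub] by simp_all
          then show ?thesis by blast
        qed
        show "scl' c u \<in> \<phi> ` I" if u: "u \<in> \<phi> ` I" for c u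
        proof -
          from u obtain x where "x \<in> I" "u = \<phi> x" by blast
          then have "scl' c u = \<phi> (scl c x)" "scl c x \<in> I"
            using scale IS A.subspace_scale[OF Isub] by auto
          then show ?thesis by blast
        qed
      qed
      show "br' u v \<in> \<phi> ` I" if uv: "u \<in> T" "v \<in> \<phi> ` I" for u v
      proof -
        from uv T obtain x y where "x \<in> S" "y \<in> I" "u = \<phi> x" "v = \<phi> y" by blast
        then have "br' u v = \<phi> (br x y)" "br x y \<in> I" using br IS Ibr by auto
        then show ?thesis by blast
      qed
    qed
    then consider "\<phi> ` I = {0}" | "\<phi> ` I = \<phi> ` S"
      using simple T unfolding lie_simple_def by blast
    then show ?thesis
    proof cases
      case 1
      then have "\<phi> ` I = \<phi> ` {0}" using \<phi>0 by simp
      then show ?thesis using inj_on_image_eq_iff[OF inj IS, of "{0}"] 0 by blast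
    next
      case 2
      then show ?thesis using inj_on_image_eq_iff[OF inj IS, of S] by blast
    qed
  qed
  moreover have "\<exists>x\<in>S. \<exists>y\<in>S. br x y \<noteq> 0"
  proof -
    obtain x y where xy: "x \<in> S" "y \<in> S" "br' (\<phi> x) (\<phi> y) \<noteq> 0"
      using simple unfolding lie_simple_def T by blast
    then have "br x y \<noteq> 0" using br[OF xy(1,2)] \<phi>0 by auto
    then show ?thesis using xy by blast
  qed
  ultimately show ?thesis using sub by (simp add: lie_simple_def)
qed

text \<open>The derived algebra lies in \<open>S\<close> and contains every bracket, hence is an
  ideal of \<open>S\<close>; it is nonzero because \<open>S\<close> is not abelian.\<close>

lemma lie_derived_eq_simple:
  assumes vs: "vector_space scl" and simple: "lie_simple scl br S"
    and range: "\<And>x y. br x y \<in> S"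
  shows "lie_derived scl br = S"
proof -
  interpret vector_space scl by (rule vs)
  let ?D = "lie_derived scl br"
  have S: "subspace S" using simple by (simp add: lie_simple_def lie_subalgebra_def)
  have D: "?D = span {br x y |x y. True}" by (simp add: lie_derived_def)
  have br: "br x y \<in> ?D" for x y unfolding D by (rule span_base) blast
  have "?D \<subseteq> S" unfolding D by (rule span_minimal[OF _ S]) (use range in blast)
  then have "lie_ideal scl br S ?D"
    using br subspace_span by (simp add: lie_ideal_def D)
  moreover have "?D \<noteq> {0}"
    using simple br unfolding lie_simple_def by blast
  ultimately show ?thesis using simple unfolding lie_simple_def by blast
qed

lemma two_neq_zero_of_CHAR:
  assumes "CHAR('a::field) \<noteq> 2"
  shows "(2::'a) \<noteq> 0"
proof
  assume "(2::'a) = 0"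
  then have "CHAR('a) dvd 2" by (metis of_nat_eq_0_iff_char_dvd of_nat_numeral)
  then have "CHAR('a) = 1 \<or> CHAR('a) = 2" using prime_nat_iff two_is_prime_nat by blast
  then show False using assms CHAR_not_1 by auto
qed

section \<open>The Lie algebra axioms\<close>

context structure_map
begin

lemma bracket_add:
  "gga_mult \<sigma> (x + y) z = gga_mult \<sigma> x z + gga_mult \<sigma> y z"
  "gga_mult \<sigma> x (y + z) = gga_mult \<sigma> x y + gga_mult \<sigma> x z"
  by (rule poly_mapping_eqI,
      simp add: lookup_gga_mult finite_Z2_3 sigma_zero lookup_add sigma_linear sum.distrib)+

lemma bracket_scale:
  "gga_mult \<sigma> (gga_scale (*s) c x) y = gga_scale (*s) c (gga_mult \<sigma> x y)"
  "gga_mult \<sigma> x (gga_scale (*s) c y) = gga_scale (*s) c (gga_mult \<sigma> x y)"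
  by (rule poly_mapping_eqI,
      simp add: lookup_gga_mult finite_Z2_3 sigma_zero lookup_gga_scale[OF vec.vector_space_axioms]
        sigma_linear vec.scale_sum_right)+

lemma bracket_self: "gga_mult \<sigma> x x = 0"
  by (rule poly_mapping_Z2_3_eqI) (simp_all only: lookup_bracket_0 lookup_bracket, simp_all)

lemma lie_algebra_gga:
  assumes two: "(2::'a) \<noteq> 0"
  shows "lie_algebra (gga_scale (*s)) (gga_mult \<sigma>)"
proof -
  interpret gl: lie_algebra mat_scale "mat_br :: 'a^8^8 \<Rightarrow> _" by (rule lie_algebra_gl)
  interpret vector_space "gga_scale (*s) :: 'a \<Rightarrow> (Z2_3 \<Rightarrow>\<^sub>0 'a^4) \<Rightarrow> _"
    by (rule vector_space_gga_scale[OF vec.vector_space_axioms])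
  have "gga_mult \<sigma> x (gga_mult \<sigma> y z) + gga_mult \<sigma> y (gga_mult \<sigma> z x) + gga_mult \<sigma> z (gga_mult \<sigma> x y) = 0"
    for x y z
  \<comment> \<open>The Jacobi identity is inherited from matrices: \<open>so8_map\<close> sends the
    cyclic sum to the one in gl_8, and in degree 0 all brackets have coefficient zero.\<close>
  proof (rule so8_map_inj)
    have "so8_map 0 = (0 :: 'a^8^8)" by (simp add: so8_map_eq_0_iff)
    then show "so8_map (gga_mult \<sigma> x (gga_mult \<sigma> y z) + gga_mult \<sigma> y (gga_mult \<sigma> z x)
        + gga_mult \<sigma> z (gga_mult \<sigma> x y)) = so8_map 0"
      by (simp add: so8_map_add so8_map_bracket[OF two] gl.jacobi)
  qed (simp add: lookup_add lookup_bracket_0)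
  then show ?thesis
    by unfold_locales (simp_all add: bracket_add bracket_scale bracket_self)
qed

end

text \<open>As the vanishing of one coefficient, membership is a single equation;
  \<open>span_gga_nonzero\<close> recovers the description as a span.\<close>

abbreviation gga_nonzero :: "(Z2_3 \<Rightarrow>\<^sub>0 'a::field^4) set" where
  "gga_nonzero \<equiv> {x. Poly_Mapping.lookup x (lab 0) = 0}"

lemma gga_decompose:
  fixes x :: "Z2_3 \<Rightarrow>\<^sub>0 'b::ab_group_add"
  shows "x = Poly_Mapping.single (lab 0) (Poly_Mapping.lookup x (lab 0))
    + (\<Sum>i\<in>{1..7}. Poly_Mapping.single (lab i) (Poly_Mapping.lookup x (lab i)))" (is "_ = ?r")
proof (rule poly_mapping_Z2_3_eqI)
  have *: "Poly_Mapping.lookup ?r (lab j) = (if j = 0 then Poly_Mapping.lookup x (lab 0) else 0) +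
      (\<Sum>i\<in>{1..7}. if i = j then Poly_Mapping.lookup x (lab i) else 0)" if "j \<le> 7" for j
    unfolding lookup_add lookup_sum lookup_single
    by (intro arg_cong2[of _ _ _ _ "(+)"] sum.cong refl) (use that in \<open>auto simp: when_def lab_eq_iff\<close>)
  show "Poly_Mapping.lookup x (lab 0) = Poly_Mapping.lookup ?r (lab 0)"
    by (subst *) simp_all
  show "Poly_Mapping.lookup x (lab j) = Poly_Mapping.lookup ?r (lab j)" if "j \<in> {1..7}" for j
    by (subst *) (use that in simp_all)
qed

lemma span_gga_nonzero:
  "module.span (gga_scale (*s)) {Poly_Mapping.single (lab i) r | r i. i \<in> {1..7}} =
    (gga_nonzero :: (Z2_3 \<Rightarrow>\<^sub>0 'a::field^4) set)"
proof -
  interpret vector_space "gga_scale (*s) :: 'a \<Rightarrow> (Z2_3 \<Rightarrow>\<^sub>0 'a^4) \<Rightarrow> _"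
    by (rule vector_space_gga_scale[OF vec.vector_space_axioms])
  have sub: "subspace (gga_nonzero :: (Z2_3 \<Rightarrow>\<^sub>0 'a^4) set)"
    by (rule subspaceI) (simp_all add: lookup_add lookup_gga_scale[OF vec.vector_space_axioms])
  let ?B = "{Poly_Mapping.single (lab i) r | r i. i \<in> {1..7}} :: (Z2_3 \<Rightarrow>\<^sub>0 'a^4) set"
  have "x \<in> span ?B" if "x \<in> gga_nonzero" for x
  proof -
    have "x = (\<Sum>i\<in>{1..7}. Poly_Mapping.single (lab i) (Poly_Mapping.lookup x (lab i)))"
      using gga_decompose[of x] that by simp
    then show ?thesis by (metis (mono_tags, lifting) mem_Collect_eq span_base span_sum)
  qed
  moreover have "?B \<subseteq> gga_nonzero"
    by (auto simp: lookup_single when_def lab_eq_iff)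
  ultimately show ?thesis using span_minimal[OF _ sub, of ?B] by blast
qed

section \<open>The derived algebra and the center\<close>

context structure_map
begin

lemma subalgebra_gga_nonzero: "lie_subalgebra (gga_scale (*s)) (gga_mult \<sigma>) gga_nonzero"
proof -
  interpret vector_space "gga_scale (*s) :: 'a \<Rightarrow> (Z2_3 \<Rightarrow>\<^sub>0 'a^4) \<Rightarrow> _"
    by (rule vector_space_gga_scale[OF vec.vector_space_axioms])
  have "subspace (gga_nonzero :: (Z2_3 \<Rightarrow>\<^sub>0 'a^4) set)"
    unfolding span_gga_nonzero[symmetric] by (rule subspace_span)
  then show ?thesis by (simp add: lie_subalgebra_def lookup_bracket_0)
qed

lemma isomorphic_so8:
  assumes two: "(2::'a) \<noteq> 0"
  shows "lie_isomorphic (gga_scale (*s)) (gga_mult \<sigma>) gga_nonzero mat_scale mat_br (so_mat :: ('a^8^8) set)"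
proof -
  have "bij_betw so8_map gga_nonzero (so_mat :: ('a^8^8) set)"
    unfolding bij_betw_def
  proof (intro conjI equalityI subsetI)
    show "inj_on so8_map (gga_nonzero :: (Z2_3 \<Rightarrow>\<^sub>0 'a^4) set)"
      by (intro inj_onI so8_map_inj) simp_all
    show "A \<in> so8_map ` gga_nonzero" if "A \<in> so_mat" for A :: "'a^8^8"
      by (rule image_eqI[where x = "so8_inv A"]) (simp_all add: so8_map_inv[OF two that] lookup_so8_inv(2))
  qed (auto simp: so8_map_in_so)
  then show ?thesis
    unfolding lie_isomorphic_def using so8_map_add so8_map_scale so8_map_bracket[OF two] by blast
qed

lemma simple_gga_nonzero:
  assumes two: "(2::'a) \<noteq> 0"
  shows "lie_simple (gga_scale (*s)) (gga_mult \<sigma>) gga_nonzero"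
  by (rule lie_simple_transfer[OF vector_space_gga_scale[OF vec.vector_space_axioms]
        vector_space_mat_scale isomorphic_so8[OF two] subalgebra_gga_nonzero so_mat_simple[OF _ two]])
    simp

lemma lie_derived_gga:
  assumes two: "(2::'a) \<noteq> 0"
  shows "lie_derived (gga_scale (*s)) (gga_mult \<sigma>) = gga_nonzero"
  by (rule lie_derived_eq_simple[OF vector_space_gga_scale[OF vec.vector_space_axioms]
        simple_gga_nonzero[OF two]])
    (simp add: lookup_bracket_0)

text \<open>The center is the kernel of \<open>so8_map\<close>. As \<open>so8_map\<close> is onto
  so_8, a central element has an image that commutes with all of so_8, and this image is zero by
  \<open>so_mat_centralizer_trivial\<close>. Conversely, \<open>lookup_bracket\<close> sees only the
  coefficients in nonzero degrees.\<close>

lemma lie_center_gga: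
  assumes two: "(2::'a) \<noteq> 0"
  shows "lie_center (gga_mult \<sigma>) = {Poly_Mapping.single (lab 0) r | r. True}"
proof -
  have "z \<in> lie_center (gga_mult \<sigma>) \<longleftrightarrow> so8_map z = 0" for z
  proof
    assume z: "z \<in> lie_center (gga_mult \<sigma>)"
    show "so8_map z = 0"
    proof (rule so_mat_centralizer_trivial[OF _ two so8_map_in_so])
      show "mat_br (so8_map z) A = 0" if "A \<in> so_mat" for A :: "'a^8^8"
      proof -
        have "mat_br (so8_map z) A = so8_map (gga_mult \<sigma> z (so8_inv A))"
          by (simp add: so8_map_bracket[OF two] so8_map_inv[OF two that])
        also have "\<dots> = 0"
          using z by (simp add: lie_center_def so8_map_eq_0_iff)
        finally show ?thesis .
      qed
    qed simp
  next
    assume "so8_map z = 0"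
    then have "Poly_Mapping.lookup z (lab (idx m)) = 0" for m
      using so8_map_eq_0_iff[of z] idx_range by blast
    then show "z \<in> lie_center (gga_mult \<sigma>)"
      unfolding lie_center_def mem_Collect_eq
      by (intro allI poly_mapping_Z2_3_eqI) (simp_all only: lookup_bracket_0 lookup_bracket,
          simp_all add: sigma1_def sigma2_def sigma4_def vec_eq_iff forall_4 vector_4)
  qed
  moreover have "so8_map z = 0 \<longleftrightarrow> (\<exists>r. z = Poly_Mapping.single (lab 0) r)" for z :: "Z2_3 \<Rightarrow>\<^sub>0 'a^4"
    unfolding so8_map_eq_0_iff
  proof
    assume "\<forall>i\<in>{1..7}. Poly_Mapping.lookup z (lab i) = 0"
    then have "z = Poly_Mapping.single (lab 0) (Poly_Mapping.lookup z (lab 0))"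
      using gga_decompose[of z] by simp
    then show "\<exists>r. z = Poly_Mapping.single (lab 0) r" by blast
  qed (auto simp: lookup_single when_def lab_eq_iff)
  ultimately show ?thesis by auto
qed

end

text \<open>The embedding \<open>Poly_Mapping.single g\<close> is linear and injective, so its range
  has the dimension of the coefficient space.\<close>

lemma dim_range_single:
  "vector_space.dim (gga_scale (*s)) {Poly_Mapping.single g r | r :: 'a::field^'n. True} = CARD('n)"
proof -
  interpret gga: vector_space "gga_scale (*s) :: 'a \<Rightarrow> ('b \<Rightarrow>\<^sub>0 'a^'n) \<Rightarrow> _"
    by (rule vector_space_gga_scale[OF vec.vector_space_axioms])
  interpret finite_dimensional_vector_space_pair_1 "(*s) :: 'a \<Rightarrow> 'a^'n \<Rightarrow> _" cart_basis
    "gga_scale (*s) :: 'a \<Rightarrow> ('b \<Rightarrow>\<^sub>0 'a^'n) \<Rightarrow> _"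
    by unfold_locales
  have lin: "Vector_Spaces.linear (*s) (gga_scale (*s)) (Poly_Mapping.single g :: 'a^'n \<Rightarrow> _)"
    unfolding Vector_Spaces.linear_iff
    by (auto simp: vec.vector_space_axioms gga.vector_space_axioms single_add
        lookup_gga_scale[OF vec.vector_space_axioms] lookup_single when_def intro!: poly_mapping_eqI)
  have "{Poly_Mapping.single g r | r :: 'a^'n. True} = range (Poly_Mapping.single g)" by auto
  moreover have "gga.dim (range (Poly_Mapping.single g)) = vec.dim (UNIV :: ('a^'n) set)"
    by (rule dim_image_eq[OF lin]) (auto intro!: inj_onI dest: arg_cong[of _ _ "\<lambda>x. Poly_Mapping.lookup x g"])
  ultimately show ?thesis by (simp add: card_cart_basis)
qed

theorem proposition2p3:
  fixes \<sigma> :: "Z2_3 \<Rightarrow> Z2_3 \<Rightarrow> 'a::field^4 \<Rightarrow> 'a^4 \<Rightarrow> 'a^4"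
  assumes "CHAR('a) \<noteq> 2" and "CHAR('a) \<noteq> 3"
    and "is_structure_map \<sigma>"
  shows "lie_algebra (gga_scale (*s)) (gga_mult \<sigma>) \<and>
    lie_center (gga_mult \<sigma>) = {Poly_Mapping.single (lab 0) r | r. True} \<and>
    vector_space.dim (gga_scale (*s)) (lie_center (gga_mult \<sigma>)) = 4 \<and>
    lie_derived (gga_scale (*s)) (gga_mult \<sigma>) =
      module.span (gga_scale (*s)) {Poly_Mapping.single (lab i) r | r i. i \<in> {1..7}} \<and>
    lie_simple (gga_scale (*s)) (gga_mult \<sigma>) (lie_derived (gga_scale (*s)) (gga_mult \<sigma>)) \<and>
    lie_isomorphic
      (gga_scale (*s)) (gga_mult \<sigma>) (lie_derived (gga_scale (*s)) (gga_mult \<sigma>))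
      mat_scale mat_br (so_mat :: ('a^8^8) set)"
proof -
  interpret structure_map \<sigma> by unfold_locales (rule assms(3))
  have two: "(2::'a) \<noteq> 0" by (rule two_neq_zero_of_CHAR[OF assms(1)])
  have four: "CARD(4) = 4" by simp
  show ?thesis
    unfolding lie_derived_gga[OF two] lie_center_gga[OF two] span_gga_nonzero
    using lie_algebra_gga[OF two] simple_gga_nonzero[OF two] isomorphic_so8[OF two]
      dim_range_single[of "lab 0", where 'a='a and 'n=4, unfolded four]
    by (intro conjI refl)
qed

end
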